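(* Let $d\ge4$ be an even integer and let $c_*=(d-1)^{d-1}$. Let $\delta_n$ denote the coefficient of $x_1^n\cdots x_d^n$ in the power series expansion at the origin of $$F_{c_*,d}(x_1,\dots,x_d)=\frac{1}{1-e_1+c_*\,e_d}.$$ Then $$\limsup_{n\to\infty}|\delta_n|^{1/(dn)}<d-1.$$
   Context: $e_1=x_1+\cdots+x_d$ and $e_d=x_1x_2\cdots x_d$. *)

theory Defs
  imports "HOL-Analysis.Analysis"
begin

text \<open>The index type \<open>'d\<close> labels the variables, so the number of variables is \<open>CARD('d)\<close>.
  A multi-index is a function \<open>\<alpha> :: 'd \<Rightarrow> nat\<close>.\<close>

definition e_1 :: "complex ^ 'd::finite \<Rightarrow> complex" where
  "e_1 x = (\<Sum>i\<in>UNIV. x $ i)"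

definition e_d :: "complex ^ 'd::finite \<Rightarrow> complex" where
  "e_d x = (\<Prod>i\<in>UNIV. x $ i)"

definition F :: "complex \<Rightarrow> complex ^ 'd::finite \<Rightarrow> complex" where
  "F c x = 1 / (1 - e_1 x + c * e_d x)"

text \<open>\<open>has_sum\<close> is unconditional, hence (over the complex numbers) absolute, convergence, so no
  order of summation over the multi-indices has to be chosen.\<close>

definition has_power_series_at_0 ::
    "(complex ^ 'd::finite \<Rightarrow> complex) \<Rightarrow> (('d \<Rightarrow> nat) \<Rightarrow> complex) \<Rightarrow> bool" where
  "has_power_series_at_0 f a \<longleftrightarrow>
     (\<forall>\<^sub>F x in nhds 0. ((\<lambda>\<alpha>. a \<alpha> * (\<Prod>i\<in>UNIV. x $ i ^ \<alpha> i)) has_sum f x) UNIV)"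

text \<open>The coefficient family is unique if it exists; it exists for every \<open>F c\<close>, whose denominator
  equals 1 at the origin.\<close>

definition power_series_coeff ::
    "(complex ^ 'd::finite \<Rightarrow> complex) \<Rightarrow> ('d \<Rightarrow> nat) \<Rightarrow> complex" where
  "power_series_coeff f = (THE a. has_power_series_at_0 f a)"

end

theory Submission
  imports Defs "HOL-Complex_Analysis.Complex_Analysis" "HOL-Real_Asymp.Real_Asymp"
    "HOL-Combinatorics.Multiset_Permutations"
begin

text \<open>
  Put \<open>m = d - 1\<close> (odd) and \<open>A k = (m k)! / (k!^m m^(m k))\<close>. Expanding \<open>F\<close> as a geometric series gives
  \<open>\<delta> n = (m^m)^n * (\<Sum>k\<le>n. (-1)^(n-k) (n + m k)! / ((n-k)! k! (m k)!) * A k)\<close>, and the coefficients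
  multiplying \<open>A k\<close> are those of the Legendre-type polynomial \<open>(d/dy)^n (y (y^m - 1))^n / n!\<close>.

  The numbers \<open>A k\<close> are the moments \<open>\<integral> y^(m k) \<rho>(y) dy\<close> over \<open>[0, 1]\<close> of a density \<open>\<rho>\<close> whose Taylor
  coefficients at 0 are the residues of \<open>M(z) = \<Gamma>(z+1) / (\<Gamma>(z/m+1)^m m^z)\<close>. By the reflection formula
  \<open>\<rho>\<close> is a combination of functions \<open>H(w^(-q) y)\<close> with \<open>w = exp(2 \<pi> i / m)\<close> and \<open>0 \<le> q \<le> m\<close>, where \<open>H\<close> is
  holomorphic on \<open>Re v < 1\<close>. Only the terms \<open>q = 0\<close> and \<open>q = m\<close> are singular at \<open>y = 1\<close>, and
  they cancel because \<open>m\<close> is odd. So \<open>\<rho>\<close> is holomorphic near the whole interval, one can integrate by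
  parts \<open>n\<close> times, and Cauchy's estimate for the \<open>n\<close>-th derivative of \<open>\<rho>\<close> gains an exponential factor over
  the value \<open>m^n\<close> of the Legendre-type polynomial at \<open>y = 1\<close>.
\<close>

section \<open>Coefficients of the power series\<close>

text \<open>At \<open>c_star\<close> the denominator \<open>1 - e_1 + c_star e_d\<close> vanishes
  together with its gradient at the point with all coordinates \<open>1 / (d - 1)\<close>. The size
  of that point suggests the growth rate \<open>d - 1\<close>; the claim is that its contribution
  cancels, which termwise bounds on an alternating sum cannot detect. Passing to moments turns the
  point into the endpoint \<open>y = 1\<close> and the cancellation into regularity of \<rho> there.
  Stirling's formula is avoided. Comparing Euler's product for \<Gamma> factor by factor shows that
  \<open>M\<close> is bounded away from its poles. Boundedness alone is too weak for a direct
  expansion of \<open>M\<close> in partial fractions, so differences of two moments are expanded,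
  and the missing constant is found to be 0 from limits at infinity. The half-plane for
  \<open>H\<close> comes from writing powers of \<Gamma> over one \<Gamma> as a product of Beta
  integrals: multiplying Taylor coefficients by moments of a kernel with values in
  \<open>[0, 1]\<close> averages a function over points \<open>v y\<close>, and these do not leave
  the half-plane.\<close>

lemma has_sum_fibers:
  fixes f :: "'a \<Rightarrow> 'c :: banach"
  assumes f: "(f has_sum S) A" and g: "\<And>k. (f has_sum g k) {x \<in> A. h x = k}"
  shows "(g has_sum S) UNIV"
proof (rule has_sum_Sigma[OF isUCont_plus])
  have inj: "inj_on snd (Sigma UNIV (\<lambda>k. {x \<in> A. h x = k}))" by (auto simp: inj_on_def)
  have "snd ` (Sigma UNIV (\<lambda>k. {x \<in> A. h x = k})) = A" by force
  with f has_sum_reindex[OF inj, of f S]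
  show "((f \<circ> snd) has_sum S) (Sigma UNIV (\<lambda>k. {x \<in> A. h x = k}))" by simp
  show "((\<lambda>y. (f \<circ> snd) (k, y)) has_sum g k) {x \<in> A. h x = k}" for k using g by simp
qed

lemma sum_words_length:
  fixes w :: "'a :: finite \<Rightarrow> 'b :: comm_semiring_1"
  shows "(\<Sum>xs | length xs = N. prod_list (map w xs)) = (\<Sum>a\<in>UNIV. w a) ^ N"
proof (induction N)
  case (Suc N)
  have e: "{xs :: 'a list. length xs = Suc N} = (\<lambda>(a, xs). a # xs) ` (UNIV \<times> {xs. length xs = N})"
    by (auto simp: length_Suc_conv image_iff)
  have "(\<Sum>xs | length xs = Suc N. prod_list (map w xs)) = (\<Sum>(a, xs)\<in>UNIV \<times> {xs. length xs = N}. w a * prod_list (map w xs))"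
    unfolding e by (subst sum.reindex) (auto simp: inj_on_def case_prod_unfold)
  also have "\<dots> = (\<Sum>a\<in>UNIV. w a) * (\<Sum>xs | length xs = N. prod_list (map w xs))"
    by (simp add: sum_product sum.cartesian_product)
  finally show ?case using Suc by simp
qed simp

text \<open>A finite set of words has bounded length, so its sum of norms is at most a partial
  geometric sum. This gives summability; grouping by length then identifies the value.\<close>

lemma has_sum_words:
  fixes w :: "'a :: finite \<Rightarrow> complex"
  assumes w: "(\<Sum>a\<in>UNIV. norm (w a)) < 1"
  shows "((\<lambda>xs. prod_list (map w xs)) has_sum 1 / (1 - (\<Sum>a\<in>UNIV. w a))) UNIV"
proof -
  define T where "T = (\<Sum>a\<in>UNIV. norm (w a))"
  have T: "0 \<le> T" "T < 1" using w by (auto simp: T_def sum_nonneg)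
  have nw: "norm (prod_list (map w xs)) = prod_list (map (\<lambda>a. norm (w a)) xs)" for xs
    by (induction xs) (auto simp: norm_mult)
  have fin: "finite {xs :: 'a list. length xs = N}" for N
    using finite_lists_length_eq[of "UNIV :: 'a set" N] by simp
  have "(\<lambda>xs. norm (prod_list (map w xs))) summable_on UNIV"
  proof (rule nonneg_bdd_above_summable_on)
    show "bdd_above (sum (\<lambda>xs. norm (prod_list (map w xs))) ` {F. F \<subseteq> UNIV \<and> finite F})"
    proof (rule bdd_aboveI2)
      fix F :: "'a list set" assume "F \<in> {F. F \<subseteq> UNIV \<and> finite F}"
      hence F: "finite F" by simp
      then obtain M where M: "\<And>xs. xs \<in> F \<Longrightarrow> length xs \<le> M"
        using finite_imageI[OF F, of length] by (metis finite_nat_set_iff_bounded_le imageI)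
      have "(\<Sum>xs\<in>F. norm (prod_list (map w xs))) \<le> (\<Sum>xs\<in>(\<Union>N\<le>M. {xs. length xs = N}). norm (prod_list (map w xs)))"
        using M fin by (intro sum_mono2) auto
      also have "\<dots> = (\<Sum>N\<le>M. \<Sum>xs | length xs = N. norm (prod_list (map w xs)))"
        using fin by (subst sum.UNION_disjoint) auto
      also have "\<dots> = (\<Sum>N\<le>M. T ^ N)" unfolding nw sum_words_length T_def ..
      also have "\<dots> \<le> 1 / (1 - T)"
      proof -
        have "(\<Sum>N<Suc M. T ^ N) \<le> (\<Sum>N. T ^ N)" using T by (intro sum_le_suminf summable_geometric) auto
        thus ?thesis using T by (simp add: suminf_geometric lessThan_Suc_atMost)
      qed
      finally show "(\<Sum>xs\<in>F. norm (prod_list (map w xs))) \<le> 1 / (1 - T)" .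
    qed
  qed auto
  hence "(\<lambda>xs. prod_list (map w xs)) summable_on UNIV" by (rule abs_summable_summable)
  then obtain S where S: "((\<lambda>xs. prod_list (map w xs)) has_sum S) UNIV" by (auto simp: summable_on_def)
  have "((\<lambda>N. (\<Sum>a\<in>UNIV. w a) ^ N) has_sum S) UNIV"
    by (rule has_sum_fibers[OF S, of length]) (use fin in \<open>auto intro!: has_sum_finiteI simp: sum_words_length\<close>)
  hence "(\<lambda>N. (\<Sum>a\<in>UNIV. w a) ^ N) sums S" by (rule has_sum_imp_sums)
  moreover have "norm (\<Sum>a\<in>UNIV. w a) < 1" using norm_sum[of w UNIV] w by linarith
  ultimately have "S = 1 / (1 - (\<Sum>a\<in>UNIV. w a))" using geometric_sums sums_unique2 by blast
  with S show ?thesis by simp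
qed

text \<open>A letter \<open>Some i\<close> stands for the summand \<open>x $ i\<close> of \<open>e_1\<close>, the letter \<open>None\<close> for the summand
  \<open>- c * e_d\<close>, so that a word stands for a term in the expansion of a power of \<open>e_1 - c * e_d\<close>.\<close>

definition letter :: "complex \<Rightarrow> complex ^ 'd::finite \<Rightarrow> 'd option \<Rightarrow> complex" where
  "letter c x a = (case a of None \<Rightarrow> - c * e_d x | Some i \<Rightarrow> x $ i)"

text \<open>Every variable occurs once in \<open>e_d\<close>, so each \<open>None\<close> raises all
  exponents by one.\<close>

definition word_exponent :: "'d option list \<Rightarrow> 'd \<Rightarrow> nat" where
  "word_exponent xs i = count_list xs None + count_list xs (Some i)"

definition word_coeff :: "complex \<Rightarrow> ('d::finite \<Rightarrow> nat) \<Rightarrow> complex" where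
  "word_coeff c \<alpha> = (\<Sum>xs | word_exponent xs = \<alpha>. (- c) ^ count_list xs None)"

lemma sum_option_UNIV: "(\<Sum>a\<in>UNIV. f a) = f None + (\<Sum>i\<in>UNIV. f (Some i))" for f :: "'d::finite option \<Rightarrow> 'b::comm_monoid_add"
  by (subst UNIV_option_conv, subst sum.insert) (auto simp: sum.reindex)

lemma prod_letters:
  fixes x :: "complex ^ 'd::finite"
  shows "prod_list (map (letter c x) xs) = (- c) ^ count_list xs None * (\<Prod>i\<in>UNIV. x $ i ^ word_exponent xs i)"
proof (induction xs)
  case (Cons a xs)
  show ?case
  proof (cases a)
    case None
    thus ?thesis using Cons by (simp add: letter_def e_d_def word_exponent_def prod.distrib mult_ac)
  next
    case (Some j)
    have "(\<Prod>i\<in>UNIV. x $ i ^ word_exponent (Some j # xs) i) = (\<Prod>i\<in>UNIV. x $ i ^ word_exponent xs i * (if i = j then x $ i else 1))"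
      by (intro prod.cong) (auto simp: word_exponent_def)
    thus ?thesis using Cons Some by (simp add: letter_def prod.distrib)
  qed
qed (simp add: word_exponent_def)

text \<open>Every letter raises some exponent. This makes the fibres of \<open>word_exponent\<close>
  finite, so \<open>word_coeff\<close> is a genuine finite sum.\<close>

lemma length_le_sum_word_exponent:
  "length xs \<le> (\<Sum>i\<in>UNIV. word_exponent xs i)" for xs :: "'d::finite option list"
proof (induction xs)
  case (Cons a xs)
  obtain j where "word_exponent (a # xs) j \<ge> Suc (word_exponent xs j)"
    by (cases a) (auto simp: word_exponent_def)
  moreover have "word_exponent (a # xs) i \<ge> word_exponent xs i" for i by (simp add: word_exponent_def)
  ultimately have "(\<Sum>i\<in>UNIV. word_exponent xs i) < (\<Sum>i\<in>UNIV. word_exponent (a # xs) i)"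
    by (intro sum_strict_mono_ex1) (auto simp: Suc_le_eq)
  thus ?case using Cons by simp
qed simp

lemma finite_word_exponent: "finite {xs :: 'd::finite option list. word_exponent xs = \<alpha>}"
proof (rule finite_subset)
  show "{xs :: 'd option list. word_exponent xs = \<alpha>} \<subseteq> {xs. set xs \<subseteq> UNIV \<and> length xs \<le> sum \<alpha> UNIV}"
    using length_le_sum_word_exponent by auto
qed (rule finite_lists_length_le, simp)

lemma F_has_power_series: "has_power_series_at_0 (F c :: complex ^ 'd::finite \<Rightarrow> complex) (word_coeff c)"
  unfolding has_power_series_at_0_def
proof -
  let ?T = "\<lambda>x :: complex ^ 'd. \<Sum>a\<in>UNIV. norm (letter c x a)"
  have "continuous_on UNIV ?T"
    unfolding sum_option_UNIV letter_def e_d_def by (auto intro!: continuous_intros)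
  hence "isCont ?T 0" by (simp add: continuous_on_eq_continuous_at)
  moreover have "?T 0 = 0" unfolding sum_option_UNIV letter_def e_d_def by simp
  ultimately have "(?T \<longlongrightarrow> 0) (nhds 0)" by (metis isCont_def tendsto_at_iff_tendsto_nhds)
  hence "eventually (\<lambda>x. ?T x < 1) (nhds 0)" by (rule order_tendstoD) simp
  thus "\<forall>\<^sub>F x in nhds 0. ((\<lambda>\<alpha>. word_coeff c \<alpha> * (\<Prod>i\<in>UNIV. x $ i ^ \<alpha> i)) has_sum F c x) (UNIV :: ('d \<Rightarrow> nat) set)"
  proof eventually_elim
    case (elim x)
    have "1 - (\<Sum>a\<in>UNIV. letter c x a) = 1 - e_1 x + c * e_d x"
      unfolding sum_option_UNIV letter_def e_1_def by simp
    with has_sum_words[OF elim] have "((\<lambda>xs. prod_list (map (letter c x) xs)) has_sum F c x) UNIV"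
      by (simp add: F_def)
    thus ?case
    proof (rule has_sum_fibers)
      fix \<alpha> :: "'d \<Rightarrow> nat"
      show "((\<lambda>xs. prod_list (map (letter c x) xs)) has_sum word_coeff c \<alpha> * (\<Prod>i\<in>UNIV. x $ i ^ \<alpha> i)) {xs \<in> UNIV. word_exponent xs = \<alpha>}"
        using finite_word_exponent[of \<alpha>]
        by (intro has_sum_finiteI) (auto simp: word_coeff_def prod_letters sum_distrib_right)
    qed
  qed
qed

section \<open>Uniqueness of multivariate power series\<close>

lemma power_series_zero_imp_coeff_zero:
  fixes a :: "nat \<Rightarrow> complex"
  assumes r: "r > 0" and s: "\<And>t. norm t < r \<Longrightarrow> (\<lambda>n. a n * t ^ n) sums 0"
  shows "a k = 0"
proof (rule ccontr)
  assume k: "a k \<noteq> 0"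
  have "a 0 = 0" using s[of 0] r by (simp add: powser_sums_zero_iff)
  hence "k > 0" using k by (cases k) auto
  \<comment> \<open>Zeros of a nontrivial power series are isolated, but here the sum is identically
    0; hence the conclusion \<open>False\<close> on the punctured disc.\<close>
  obtain \<sigma> where "\<sigma> > 0" "\<And>z::complex. norm z \<le> \<sigma> \<Longrightarrow> z \<noteq> 0 \<Longrightarrow> False"
    by (rule powser_0_nonzero[OF r, of 0 a "\<lambda>_. 0" k]) (use s k \<open>k > 0\<close> in auto)
  from this(2)[of "of_real \<sigma>"] this(1) show False by simp
qed

text \<open>Induction on the set \<open>S\<close> of variables whose exponents are already frozen at
  \<beta>. To freeze one more variable \<open>j\<close>, the terms are sorted by the exponent of
  \<open>j\<close>, which leaves a power series in one variable \<open>t\<close> that vanishes near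
  0.\<close>

lemma multivariate_power_series_zero:
  fixes g :: "('d::finite \<Rightarrow> nat) \<Rightarrow> complex"
  assumes r: "r > 0"
    and g: "\<And>x. (\<And>i. norm (x i) < r) \<Longrightarrow> ((\<lambda>\<alpha>. g \<alpha> * (\<Prod>i\<in>UNIV. x i ^ \<alpha> i)) has_sum 0) UNIV"
  shows "g \<beta> = 0"
proof -
  have "\<forall>x. (\<forall>i. norm (x i) < r) \<longrightarrow> ((\<lambda>\<alpha>. g \<alpha> * (\<Prod>i\<in>-S. x i ^ \<alpha> i)) has_sum 0) {\<alpha>. \<forall>i\<in>S. \<alpha> i = \<beta> i}"
    if "finite S" for S
    using that
  proof (induction S)
    case empty
    thus ?case using g by simp
  next
    case (insert j S)
    show ?case
    proof (intro allI impI)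
      fix x :: "'d \<Rightarrow> complex" assume x: "\<forall>i. norm (x i) < r"
      let ?A = "{\<alpha>. \<forall>i\<in>S. \<alpha> i = \<beta> i}"
      let ?f = "\<lambda>\<alpha>. g \<alpha> * (\<Prod>i\<in>- insert j S. x i ^ \<alpha> i)"
      have sum0: "((\<lambda>\<alpha>. ?f \<alpha> * t ^ \<alpha> j) has_sum 0) ?A" if t: "norm t < r" for t
      proof -
        have "((\<lambda>\<alpha>. g \<alpha> * (\<Prod>i\<in>-S. (x(j := t)) i ^ \<alpha> i)) has_sum 0) ?A"
          using insert.IH x t by simp
        moreover have "(\<Prod>i\<in>-S. (x(j := t)) i ^ \<alpha> i) = (\<Prod>i\<in>- insert j S. x i ^ \<alpha> i) * t ^ \<alpha> j" for \<alpha>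
        proof -
          have "- S = insert j (- insert j S)" using insert.hyps by auto
          hence "(\<Prod>i\<in>-S. (x(j := t)) i ^ \<alpha> i) = t ^ \<alpha> j * (\<Prod>i\<in>- insert j S. (x(j := t)) i ^ \<alpha> i)"
            by simp
          also have "(\<Prod>i\<in>- insert j S. (x(j := t)) i ^ \<alpha> i) = (\<Prod>i\<in>- insert j S. x i ^ \<alpha> i)"
            by (intro prod.cong) auto
          finally show ?thesis by simp
        qed
        ultimately show ?thesis by (simp add: mult.assoc)
      qed
      define G where "G = (\<lambda>k. infsum ?f {\<alpha> \<in> ?A. \<alpha> j = k})"
      have G: "(?f has_sum G k) {\<alpha> \<in> ?A. \<alpha> j = k}" for k
      proof -
        \<comment> \<open>Any nonzero point of the disc serves: dividing by \<open>t ^ k\<close>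
          makes the fibre over \<open>k\<close> summable.\<close>
        define t where "t = (of_real (r / 2) :: complex)"
        have t: "norm t < r" "t \<noteq> 0" using r by (auto simp: t_def)
        have "(\<lambda>\<alpha>. ?f \<alpha> * t ^ \<alpha> j) summable_on {\<alpha> \<in> ?A. \<alpha> j = k}"
          by (rule summable_on_subset_banach[of _ ?A]) (use sum0[OF t(1)] in \<open>auto simp: summable_on_def\<close>)
        hence "(\<lambda>\<alpha>. ?f \<alpha> * t ^ k) summable_on {\<alpha> \<in> ?A. \<alpha> j = k}"
          by (rule summable_on_cong[THEN iffD1, rotated]) auto
        hence "(\<lambda>\<alpha>. ?f \<alpha> * t ^ k * inverse (t ^ k)) summable_on {\<alpha> \<in> ?A. \<alpha> j = k}"
          by (rule summable_on_cmult_left)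
        hence "?f summable_on {\<alpha> \<in> ?A. \<alpha> j = k}" using t by (simp add: mult.assoc)
        thus ?thesis unfolding G_def by (rule has_sum_infsum)
      qed
      have "(\<lambda>k. G k * t ^ k) sums 0" if t: "norm t < r" for t
      proof (rule has_sum_imp_sums)
        show "((\<lambda>k. G k * t ^ k) has_sum 0) UNIV"
          using sum0[OF t]
        proof (rule has_sum_fibers[where h = "\<lambda>\<alpha>. \<alpha> j"])
          fix k
          show "((\<lambda>\<alpha>. ?f \<alpha> * t ^ \<alpha> j) has_sum G k * t ^ k) {\<alpha> \<in> ?A. \<alpha> j = k}"
            using has_sum_cmult_left[OF G[of k], of "t ^ k"] by (rule has_sum_cong[THEN iffD1, rotated]) auto
        qed
      qed
      from power_series_zero_imp_coeff_zero[OF r this, of "\<beta> j"] G[of "\<beta> j"]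
      show "(?f has_sum 0) {\<alpha>. \<forall>i\<in>insert j S. \<alpha> i = \<beta> i}"
        by (auto simp: conj_commute)
    qed
  qed
  note this[of UNIV, rule_format, of "\<lambda>_. 0"]
  moreover have "{\<alpha>. \<forall>i\<in>UNIV. \<alpha> i = \<beta> i} = {\<beta>}" by auto
  ultimately have "(g has_sum 0) {\<beta>}" using r by simp
  from has_sum_unique[OF this has_sum_finite[of "{\<beta>}" g]] show ?thesis by simp
qed

lemma has_power_series_at_0_unique:
  fixes f :: "complex ^ 'd::finite \<Rightarrow> complex"
  assumes "has_power_series_at_0 f a" "has_power_series_at_0 f b"
  shows "a = b"
proof
  fix \<beta>
  have "eventually (\<lambda>x. ((\<lambda>\<alpha>. (a \<alpha> - b \<alpha>) * (\<Prod>i\<in>UNIV. x $ i ^ \<alpha> i)) has_sum 0) UNIV) (nhds (0 :: complex ^ 'd))"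
    using assms unfolding has_power_series_at_0_def
  proof eventually_elim
    case (elim x)
    from has_sum_add[OF elim(1) has_sum_cmult_right[OF elim(2), of "-1"]] show ?case
      by (simp add: left_diff_distrib)
  qed
  then obtain e where e: "e > 0" and sum0: "\<And>x :: complex ^ 'd. dist x 0 < e \<Longrightarrow> ((\<lambda>\<alpha>. (a \<alpha> - b \<alpha>) * (\<Prod>i\<in>UNIV. x $ i ^ \<alpha> i)) has_sum 0) UNIV"
    by (auto simp: eventually_nhds_metric)
  \<comment> \<open>The polydisc of radius \<open>e / CARD('d)\<close> lies in the ball of radius
    \<open>e\<close>, the norm being at most the sum of the coordinate norms.\<close>
  have "a \<beta> - b \<beta> = 0"
  proof (rule multivariate_power_series_zero[where r = "e / real CARD('d)"])
    show "e / real CARD('d) > 0" using e by simp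
    fix x :: "'d \<Rightarrow> complex" assume x: "\<And>i. norm (x i) < e / real CARD('d)"
    have "norm (vec_lambda x) \<le> (\<Sum>i\<in>UNIV. norm (x i))"
      unfolding norm_vec_def by (rule order.trans[OF L2_set_le_sum]) auto
    also have "\<dots> < (\<Sum>i\<in>(UNIV :: 'd set). e / real CARD('d))" using x by (intro sum_strict_mono) auto
    also have "\<dots> = e" by simp
    finally show "((\<lambda>\<alpha>. (a \<alpha> - b \<alpha>) * (\<Prod>i\<in>UNIV. x i ^ \<alpha> i)) has_sum 0) UNIV"
      using sum0[of "vec_lambda x"] by (simp add: dist_norm)
  qed
  thus "a \<beta> = b \<beta>" by simp
qed

lemma power_series_coeff_F: "power_series_coeff (F c :: complex ^ 'd::finite \<Rightarrow> complex) = word_coeff c"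
  unfolding power_series_coeff_def
  using F_has_power_series has_power_series_at_0_unique by (intro the_equality) blast+

section \<open>Diagonal coefficients as multinomial sums\<close>

lemma card_diagonal_words:
  "of_nat (card {xs :: 'd::finite option list. count_list xs None = j \<and> (\<forall>i. count_list xs (Some i) = k)}) =
     (fact (j + CARD('d) * k) / (fact j * fact k ^ CARD('d)) :: 'a :: field_char_0)"
proof -
  define M where "M = replicate_mset j None + (\<Sum>i\<in>UNIV. replicate_mset k (Some i :: 'd option))"
  have c: "count M None = j" "count M (Some i) = k" for i
    by (auto simp: M_def count_sum sum.delta')
  have "xs \<in> permutations_of_multiset M \<longleftrightarrow> count_list xs None = j \<and> (\<forall>i. count_list xs (Some i) = k)" for xs
    unfolding permutations_of_multiset_def multiset_eq_iff mem_Collect_eq count_mset split_option_all c by blast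
  hence e: "{xs :: 'd option list. count_list xs None = j \<and> (\<forall>i. count_list xs (Some i) = k)} = permutations_of_multiset M" by blast
  have "(\<Prod>x\<in>set_mset M. fact (count M x)) = (\<Prod>x\<in>UNIV. fact (count M x) :: nat)"
    by (intro prod.mono_neutral_left) (auto simp: not_in_iff)
  also have "\<dots> = fact j * fact k ^ CARD('d)"
    by (subst UNIV_option_conv, subst prod.insert) (auto simp: prod.reindex c)
  finally have p: "(\<Prod>x\<in>set_mset M. fact (count M x)) = (fact j * fact k ^ CARD('d) :: nat)" .
  have "size M = j + CARD('d) * k" by (simp add: M_def size_multiset_sum)
  with card_permutations_of_multiset_aux[of M] p
  have "card (permutations_of_multiset M) * (fact j * fact k ^ CARD('d)) = fact (j + CARD('d) * k)" by simp
  from arg_cong[OF this, of "of_nat :: nat \<Rightarrow> 'a"]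
  show ?thesis unfolding e by (simp add: divide_simps)
qed

lemma word_coeff_diagonal:
  "word_coeff c (\<lambda>_ :: 'd::finite. n) = (\<Sum>k\<le>n. (- c) ^ (n - k) * (fact (n - k + CARD('d) * k) / (fact (n - k) * fact k ^ CARD('d))))"
proof -
  let ?W = "\<lambda>k. {xs :: 'd option list. count_list xs None = n - k \<and> (\<forall>i. count_list xs (Some i) = k)}"
  have e: "{xs :: 'd option list. word_exponent xs = (\<lambda>_. n)} = (\<Union>k\<le>n. ?W k)"
  proof (intro equalityI subsetI)
    fix xs :: "'d option list" assume "xs \<in> {xs. word_exponent xs = (\<lambda>_. n)}"
    hence *: "count_list xs None + count_list xs (Some i) = n" for i by (simp add: word_exponent_def fun_eq_iff)
    hence "count_list xs None \<le> n" by (metis le_add1)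
    with * have "xs \<in> ?W (n - count_list xs None)" by (auto simp: eq_diff_iff) (metis diff_add_inverse)
    thus "xs \<in> (\<Union>k\<le>n. ?W k)" by auto
  next
    fix xs :: "'d option list" assume "xs \<in> (\<Union>k\<le>n. ?W k)"
    thus "xs \<in> {xs. word_exponent xs = (\<lambda>_. n)}" by (auto simp: word_exponent_def fun_eq_iff)
  qed
  have fin: "finite (?W k)" if "k \<le> n" for k
    by (rule finite_subset[OF _ finite_word_exponent[of "\<lambda>_. n"]]) (use e that in blast)
  have "word_coeff c (\<lambda>_ :: 'd. n) = (\<Sum>k\<le>n. \<Sum>xs\<in>?W k. (- c) ^ count_list xs None)"
    unfolding word_coeff_def e using fin by (intro sum.UNION_disjoint) auto
  also have "\<dots> = (\<Sum>k\<le>n. of_nat (card (?W k)) * (- c) ^ (n - k))"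
    by (intro sum.cong) auto
  finally show ?thesis unfolding card_diagonal_words by (simp add: mult.commute)
qed

section \<open>The moment function and its partial fractions\<close>

text \<open>This is \<open>m^w \<Gamma>(w/m)^m / \<Gamma>(w)\<close>. Through the reflection formula
  it governs both the size of \<open>moment_fun\<close> left of the origin and its residues.\<close>

definition gamma_power_ratio :: "nat \<Rightarrow> complex \<Rightarrow> complex" where
  "gamma_power_ratio m w = exp (w * of_real (ln (real m))) * Gamma (w / of_nat m) ^ m * rGamma w"

definition moment_fun :: "nat \<Rightarrow> complex \<Rightarrow> complex" where
  "moment_fun m z = Gamma (z + 1) * rGamma (z / of_nat m + 1) ^ m * exp (- z * of_real (ln (real m)))"

section \<open>Bounds on half-planes from Euler's product\<close>

lemma norm_shift_quotient_le:
  fixes u :: complex and s v :: real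
  assumes "Re u \<ge> v" "v > 0" "s \<ge> 0"
  shows "norm ((u + of_real s) / u) \<le> (v + s) / v"
proof -
  have nu: "norm u \<ge> v" using assms complex_Re_le_cmod[of u] by linarith
  hence u0: "u \<noteq> 0" using assms by auto
  have "norm ((u + of_real s) / u) = norm (1 + of_real s / u)" using u0 by (simp add: field_simps)
  also have "\<dots> \<le> 1 + s / norm u" using assms
    by (metis abs_of_nonneg norm_divide norm_of_real norm_one norm_triangle_ineq)
  also have "s / norm u \<le> s / v" using assms nu u0 by (intro divide_left_mono) auto
  finally show ?thesis using assms by (simp add: field_simps)
qed

text \<open>Cutting the product into \<open>N\<close> blocks of length \<open>m\<close> matches it
  with \<open>pochhammer_power_blocks\<close>, so that the quotient of the two products can be
  bounded factor by factor.\<close>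

lemma pochhammer_mult_blocks:
  fixes w :: "'a :: comm_semiring_1"
  shows "pochhammer w (m * N) = (\<Prod>k<N. \<Prod>i<m. w + of_nat (m * k + i))"
proof -
  have "pochhammer w (m * N) = prod (\<lambda>j. w + of_nat j) {..<N * m}"
    by (simp add: pochhammer_prod atLeast0LessThan mult.commute)
  also have "\<dots> = (\<Prod>k<N. prod (\<lambda>j. w + of_nat j) {k * m..<k * m + m})"
    by (rule prod.nat_group[symmetric])
  also have "\<dots> = (\<Prod>k<N. \<Prod>i<m. w + of_nat (m * k + i))"
  proof (rule prod.cong[OF refl])
    fix k
    have "prod (\<lambda>j. w + of_nat j) {0 + k * m..<m + k * m} = (\<Prod>i\<in>{0..<m}. w + of_nat (i + k * m))"
      by (rule prod.shift_bounds_nat_ivl)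
    thus "prod (\<lambda>j. w + of_nat j) {k * m..<k * m + m} = (\<Prod>i<m. w + of_nat (m * k + i))"
      by (simp add: atLeast0LessThan ac_simps)
  qed
  finally show ?thesis .
qed

lemma pochhammer_power_blocks:
  fixes w :: "'a :: comm_semiring_1"
  shows "pochhammer w N ^ m = (\<Prod>k<N. \<Prod>i<m. w + of_nat k)"
  by (simp add: pochhammer_prod atLeast0LessThan prod_power_distrib)

text \<open>Euler's limit is taken along \<open>m * N\<close> at \<open>w\<close> and along
  \<open>N\<close> at \<open>w / m\<close>. The powers of \<open>N\<close> then cancel, and
  \<open>exp (w * ln m)\<close> absorbs the power of \<open>m\<close>.\<close>

lemma gamma_power_ratio_limit:
  assumes "m > 0" "Re w > 0"
  shows "(\<lambda>N. of_real (fact (N - 1) ^ m / fact (m * N - 1)) *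
             (pochhammer w (m * N) / pochhammer (w / of_nat m) N ^ m)) \<longlonglongrightarrow> gamma_power_ratio m w"
proof -
  have l1: "(\<lambda>N. Gamma_series' w (m * N)) \<longlonglongrightarrow> Gamma w"
    using LIMSEQ_subseq_LIMSEQ[OF Gamma_series'_LIMSEQ, of "\<lambda>N. m * N" w] assms
    by (simp add: strict_mono_def o_def)
  have wnp: "w \<notin> \<int>\<^sub>\<le>\<^sub>0"
  proof
    assume "w \<in> \<int>\<^sub>\<le>\<^sub>0"
    thus False using assms by (auto elim!: nonpos_Ints_cases)
  qed
    have "(\<lambda>N. exp (w * of_real (ln (real m))) * Gamma_series' (w / of_nat m) N ^ m *
            inverse (Gamma_series' w (m * N))) \<longlonglongrightarrow>
          exp (w * of_real (ln (real m))) * Gamma (w / of_nat m) ^ m * inverse (Gamma w)"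
      using wnp by (intro tendsto_intros l1 Gamma_series'_LIMSEQ) (auto simp: Gamma_eq_zero_iff)
    moreover have "eventually (\<lambda>N. exp (w * of_real (ln (real m))) * Gamma_series' (w / of_nat m) N ^ m *
            inverse (Gamma_series' w (m * N)) = of_real (fact (N - 1) ^ m / fact (m * N - 1)) *
             (pochhammer w (m * N) / pochhammer (w / of_nat m) N ^ m)) sequentially"
      using eventually_gt_at_top[of 0]
    proof eventually_elim
      case (elim N)
      have e: "exp (w / of_nat m * of_real (ln (real N))) ^ m = exp (w * of_real (ln (real N)))"
        using assms by (simp flip: exp_of_nat_mult)
      have "exp (w * complex_of_real (ln (real (m * N)))) =
          exp (w * of_real (ln (real m))) * exp (w * of_real (ln (real N)))"
        using assms elim by (simp add: ln_mult algebra_simps exp_add)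
      thus ?case using assms elim unfolding Gamma_series'_def power_divide power_mult_distrib e
        by (simp add: divide_simps)
    qed
    ultimately show ?thesis unfolding gamma_power_ratio_def rGamma_inverse_Gamma
      by (rule Lim_transform_eventually)
qed

text \<open>Each factor of the product in \<open>gamma_power_ratio_limit\<close> is
  \<open>m (1 + i / u)\<close> with \<open>u = w + m k\<close>, and its norm does not decrease when
  \<open>u\<close> is replaced by the positive lower bound \<open>x0 + m k\<close> of its real part.
  The bound is therefore uniform in \<open>Im w\<close>.\<close>

lemma norm_gamma_power_ratio_le:
  assumes "m > 0" "x0 > 0" "Re w \<ge> x0"
  shows "norm (gamma_power_ratio m w) \<le> norm (gamma_power_ratio m (of_real x0))"
proof (rule LIMSEQ_le[OF tendsto_norm[OF gamma_power_ratio_limit] tendsto_norm[OF gamma_power_ratio_limit]])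
  show "\<exists>K. \<forall>N\<ge>K. norm (complex_of_real (fact (N - 1) ^ m / fact (m * N - 1)) *
             (pochhammer w (m * N) / pochhammer (w / of_nat m) N ^ m)) \<le>
          norm (complex_of_real (fact (N - 1) ^ m / fact (m * N - 1)) *
             (pochhammer (of_real x0) (m * N) / pochhammer (of_real x0 / of_nat m) N ^ m))"
  proof (intro exI[of _ 0] allI impI)
    fix N :: nat
    have fac: "norm ((w + of_nat (m * k + i)) / (w / of_nat m + of_nat k)) \<le>
          norm ((complex_of_real x0 + of_nat (m * k + i)) / (of_real x0 / of_nat m + of_nat k))" for k i
    proof -
      define v where "v = x0 + real (m * k)"
      define u where "u = w + of_nat (m * k)"
      have v: "v > 0" using assms by (simp add: v_def add_pos_nonneg)
      have u: "Re u \<ge> v" using assms by (simp add: u_def v_def)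
      have e1: "(w + of_nat (m * k + i)) / (w / of_nat m + of_nat k) = of_nat m * ((u + of_real (real i)) / u)"
        using assms by (simp add: u_def field_simps)
      have e2: "(of_real x0 + of_nat (m * k + i)) / (of_real x0 / of_nat m + of_nat k) =
         complex_of_real (real m * ((v + real i) / v))"
        using assms by (simp add: v_def field_simps)
      show ?thesis unfolding e1 e2 norm_mult[of "of_nat m"] norm_of_real
      proof -
        have "norm (of_nat m :: complex) * norm ((u + of_real (real i)) / u) \<le> real m * ((v + real i) / v)"
          using mult_left_mono[OF norm_shift_quotient_le[OF u v, of "real i"], of "real m"] by simp
        thus "norm (of_nat m :: complex) * norm ((u + of_real (real i)) / u) \<le> \<bar>real m * ((v + real i) / v)\<bar>"
          by linarith
      qed
    qed
    have "norm (pochhammer w (m * N) / pochhammer (w / of_nat m) N ^ m) \<le>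
          norm (pochhammer (complex_of_real x0) (m * N) / pochhammer (of_real x0 / of_nat m) N ^ m)"
      unfolding pochhammer_mult_blocks pochhammer_power_blocks prod_dividef[symmetric] prod_norm[symmetric]
      by (intro prod_mono conjI fac prod_nonneg) auto
    thus "norm (complex_of_real (fact (N - 1) ^ m / fact (m * N - 1)) *
             (pochhammer w (m * N) / pochhammer (w / of_nat m) N ^ m)) \<le>
          norm (complex_of_real (fact (N - 1) ^ m / fact (m * N - 1)) *
             (pochhammer (of_real x0) (m * N) / pochhammer (of_real x0 / of_nat m) N ^ m))"
      unfolding norm_mult by (intro mult_left_mono) auto
  qed
qed (use assms in auto)

lemma moment_fun_limit:
  assumes "m > 0" "Re z > -1"
  shows "(\<lambda>N. of_real (fact (m * N - 1) / fact (N - 1) ^ m * (real m * real N / real N ^ m)) *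
             (pochhammer (z / of_nat m + 1) N ^ m / pochhammer (z + 1) (m * N))) \<longlonglongrightarrow> moment_fun m z"
proof -
  have l1: "(\<lambda>N. Gamma_series' (z + 1) (m * N)) \<longlonglongrightarrow> Gamma (z + 1)"
    using LIMSEQ_subseq_LIMSEQ[OF Gamma_series'_LIMSEQ, of "\<lambda>N. m * N" "z + 1"] assms
    by (simp add: strict_mono_def o_def)
  have rp: "Re (z / of_nat m + 1) > 0" using assms by (simp add: field_simps)
  have nz: "z / of_nat m + 1 \<notin> \<int>\<^sub>\<le>\<^sub>0"
  proof
    assume "z / of_nat m + 1 \<in> \<int>\<^sub>\<le>\<^sub>0"
    then obtain n where n: "z / of_nat m + 1 = of_int n" "n \<le> 0" by (auto elim!: nonpos_Ints_cases)
    have "Re (z / of_nat m + 1) = of_int n" unfolding n(1) by simp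
    thus False using rp n(2) by simp
  qed
  have "(\<lambda>N. Gamma_series' (z + 1) (m * N) * inverse (Gamma_series' (z / of_nat m + 1) N) ^ m *
          exp (- z * of_real (ln (real m)))) \<longlonglongrightarrow>
          Gamma (z + 1) * inverse (Gamma (z / of_nat m + 1)) ^ m * exp (- z * of_real (ln (real m)))"
    using nz by (intro tendsto_intros l1 Gamma_series'_LIMSEQ) (auto simp: Gamma_eq_zero_iff)
  moreover have "eventually (\<lambda>N. Gamma_series' (z + 1) (m * N) *
          inverse (Gamma_series' (z / of_nat m + 1) N) ^ m * exp (- z * of_real (ln (real m))) =
          of_real (fact (m * N - 1) / fact (N - 1) ^ m * (real m * real N / real N ^ m)) *
             (pochhammer (z / of_nat m + 1) N ^ m / pochhammer (z + 1) (m * N))) sequentially"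
    using eventually_gt_at_top[of 0]
  proof eventually_elim
    case (elim N)
    have e0: "exp (of_real (ln (real N))) = (of_nat N :: complex)"
       "exp (of_real (ln (real m))) = (of_nat m :: complex)"
      using elim assms by (metis exp_ln exp_of_real of_nat_0_less_iff of_real_of_nat_eq)+
    have "exp ((z / of_nat m + 1) * of_real (ln (real N))) ^ m =
        exp (z * of_real (ln (real N)) + of_nat m * of_real (ln (real N)))"
      using assms by (simp flip: exp_of_nat_mult add: algebra_simps)
    also have "\<dots> = exp (z * of_real (ln (real N))) * of_nat N ^ m"
      by (simp add: exp_add exp_of_nat_mult e0)
    finally have e: "exp ((z / of_nat m + 1) * of_real (ln (real N))) ^ m = exp (z * of_real (ln (real N))) * of_nat N ^ m" .
    have "exp ((z + 1) * complex_of_real (ln (real (m * N)))) =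
          exp (z * of_real (ln (real m))) * of_nat m * exp (z * of_real (ln (real N))) * of_nat N"
      using assms elim by (simp add: ln_mult algebra_simps exp_add e0)
    thus ?case using assms elim unfolding Gamma_series'_def power_divide power_mult_distrib power_inverse e
      by (simp add: exp_minus field_simps)
  qed
  ultimately show ?thesis unfolding moment_fun_def rGamma_inverse_Gamma
    by (rule Lim_transform_eventually)
qed

text \<open>The method of \<open>norm_gamma_power_ratio_le\<close> with factors
  \<open>(1 + j / u) / m\<close>, where \<open>u = z + 1 + m k + i\<close> and
  \<open>j = m - 1 - i\<close> is nonnegative inside a block.\<close>

lemma norm_moment_fun_le:
  assumes "m > 0" "x0 > -1" "Re z \<ge> x0"
  shows "norm (moment_fun m z) \<le> norm (moment_fun m (of_real x0))"
proof (rule LIMSEQ_le[OF tendsto_norm[OF moment_fun_limit] tendsto_norm[OF moment_fun_limit]])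
  show "\<exists>K. \<forall>N\<ge>K. norm (complex_of_real (fact (m * N - 1) / fact (N - 1) ^ m * (real m * real N / real N ^ m)) *
             (pochhammer (z / of_nat m + 1) N ^ m / pochhammer (z + 1) (m * N))) \<le>
          norm (complex_of_real (fact (m * N - 1) / fact (N - 1) ^ m * (real m * real N / real N ^ m)) *
             (pochhammer (of_real x0 / of_nat m + 1) N ^ m / pochhammer (of_real x0 + 1) (m * N)))"
  proof (intro exI[of _ 0] allI impI)
    fix N :: nat
    have fac: "norm ((z / of_nat m + 1 + of_nat k) / (z + 1 + of_nat (m * k + i))) \<le>
          norm ((complex_of_real x0 / of_nat m + 1 + of_nat k) / (of_real x0 + 1 + of_nat (m * k + i)))"
      if "i < m" for k i
    proof -
      define v where "v = x0 + 1 + real (m * k + i)"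
      define u where "u = z + 1 + of_nat (m * k + i)"
      define j where "j = m - 1 - i"
      have j: "m = 1 + i + j" using that by (auto simp: j_def)
      have jr: "real m = 1 + real i + real j" using arg_cong[OF j, of real] by simp
      have jc: "(of_nat m :: complex) = 1 + of_nat i + of_nat j" using arg_cong[OF j, of "of_nat :: nat \<Rightarrow> complex"] by simp
      have v: "v > 0" using assms by (simp add: v_def add_pos_nonneg)
      have u: "Re u \<ge> v" using assms by (simp add: u_def v_def)
      have m0: "real m \<noteq> 0" "of_nat m \<noteq> (0::complex)" using assms by auto
      have e1: "(z / of_nat m + 1 + of_nat k) / (z + 1 + of_nat (m * k + i)) = ((u + of_real (real j)) / u) / of_nat m"
      proof -
        have "u + of_real (real j) = (z / of_nat m + 1 + of_nat k) * of_nat m"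
          using m0 by (simp add: u_def field_simps) (simp add: jc algebra_simps)
        thus ?thesis using m0 by (simp add: u_def)
      qed
      have e2: "(of_real x0 / of_nat m + 1 + of_nat k) / (of_real x0 + 1 + of_nat (m * k + i)) =
         complex_of_real (((v + real j) / v) / real m)"
      proof -
        have "v + real j = (x0 / real m + 1 + real k) * real m"
          using m0 by (simp add: v_def field_simps) (simp add: jr algebra_simps)
        hence "(v + real j) / v / real m = (x0 / real m + 1 + real k) / v" using m0 by simp
        thus ?thesis by (simp only: v_def) simp
      qed
      show ?thesis unfolding e1 e2 norm_divide[of _ "of_nat m"] norm_of_real
      proof -
        have "norm ((u + of_real (real j)) / u) / norm (of_nat m :: complex) \<le> (v + real j) / v / real m"
          using divide_right_mono[OF norm_shift_quotient_le[OF u v, of "real j"], of "real m"] by simp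
        thus "norm ((u + of_real (real j)) / u) / norm (of_nat m :: complex) \<le> \<bar>(v + real j) / v / real m\<bar>"
          by linarith
      qed
    qed
    have "norm (pochhammer (z / of_nat m + 1) N ^ m / pochhammer (z + 1) (m * N)) \<le>
          norm (pochhammer (complex_of_real x0 / of_nat m + 1) N ^ m / pochhammer (of_real x0 + 1) (m * N))"
      unfolding pochhammer_mult_blocks pochhammer_power_blocks prod_dividef[symmetric] prod_norm[symmetric]
      by (intro prod_mono conjI fac prod_nonneg) auto
    thus "norm (complex_of_real (fact (m * N - 1) / fact (N - 1) ^ m * (real m * real N / real N ^ m)) *
             (pochhammer (z / of_nat m + 1) N ^ m / pochhammer (z + 1) (m * N))) \<le>
          norm (complex_of_real (fact (m * N - 1) / fact (N - 1) ^ m * (real m * real N / real N ^ m)) *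
             (pochhammer (of_real x0 / of_nat m + 1) N ^ m / pochhammer (of_real x0 + 1) (m * N)))"
      unfolding norm_mult by (intro mult_left_mono) auto
  qed
qed (use assms in auto)

section \<open>Reflection and bounds left of the origin\<close>

text \<open>Reflection at \<open>w\<close> and at \<open>w / m\<close>. The condition on
  \<open>rGamma\<close> excludes the poles, at which \<open>Gamma\<close> has the default value 0
  and the identity can fail.\<close>

lemma moment_fun_minus:
  assumes "m > 0" "Re w > 0" "rGamma (1 - w) \<noteq> 0"
  shows "moment_fun m (- w) * sin (of_real pi * w) =
     gamma_power_ratio m w * sin (of_real pi * (w / of_nat m)) ^ m * of_real pi / of_real pi ^ m"
proof -
  have np: "v \<notin> \<int>\<^sub>\<le>\<^sub>0" if "Re v > 0" for v
    using that by (auto elim!: nonpos_Ints_cases)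
  have "Re (w / of_nat m) > 0" using assms by simp
  hence G: "Gamma (w / of_nat m) \<noteq> 0"
    using assms by (simp_all add: Gamma_eq_zero_iff np)
  have r1: "rGamma (1 - w / of_nat m) = Gamma (w / of_nat m) * sin (of_real pi * (w / of_nat m)) / of_real pi"
    using rGamma_reflection_complex[of "w / of_nat m"] G
    by (simp add: rGamma_inverse_Gamma[of "w / of_nat m"] divide_simps mult_ac split: if_splits)
  have r2: "sin (of_real pi * w) = of_real pi * rGamma w * rGamma (1 - w)"
    using rGamma_reflection_complex[of w] by (simp add: field_simps)
  have r3: "Gamma (1 - w) * rGamma (1 - w) = 1" using assms(3) by (simp add: rGamma_inverse_Gamma)
  have e: "- w + 1 = 1 - w" "- w / of_nat m + 1 = 1 - w / of_nat m" by simp_all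
  have "moment_fun m (- w) * sin (of_real pi * w) = (Gamma (1 - w) * rGamma (1 - w)) *
      (rGamma (1 - w / of_nat m) ^ m * exp (w * of_real (ln (real m))) * of_real pi * rGamma w)"
    unfolding moment_fun_def e r2 by (simp add: mult_ac)
  also have "\<dots> = gamma_power_ratio m w * sin (of_real pi * (w / of_nat m)) ^ m * of_real pi / of_real pi ^ m"
    unfolding r3 gamma_power_ratio_def r1 power_divide power_mult_distrib by (simp add: mult_ac)
  finally show ?thesis .
qed

lemma norm_sin_le_exp: "norm (sin z) \<le> exp \<bar>Im z\<bar>" for z :: complex
proof (rule power2_le_imp_le)
  define E where "E = exp (2 * \<bar>Im z\<bar>)"
  have E: "E \<ge> 1" by (simp add: E_def)
  hence iE: "inverse E \<le> 1" by (simp add: inverse_le_1_iff)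
  have s: "exp (2 * Im z) + inverse (exp (2 * Im z)) = E + inverse E"
    by (cases "Im z \<ge> 0") (simp_all add: E_def exp_minus)
  have "norm (sin z) ^ 2 = (E + inverse E - 2 * cos (2 * Re z)) / 4"
    unfolding norm_sin_squared s ..
  also have "\<dots> \<le> (E + 1 + 2) / 4"
  proof -
    have "inverse E - 2 * cos (2 * Re z) \<le> 1 - 2 * (-1)"
      using iE by (intro diff_mono mult_left_mono cos_ge_minus_one) auto
    thus ?thesis by simp
  qed
  also have "\<dots> \<le> E" using E by simp
  also have "E = exp \<bar>Im z\<bar> ^ 2" by (simp add: E_def exp_of_nat_mult[of 2, simplified, symmetric])
  finally show "norm (sin z) ^ 2 \<le> exp \<bar>Im z\<bar> ^ 2" .
qed auto

text \<open>After scaling by \<pi>, the two cases cover the horizontal sides and the left vertical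
  side of the contours used later. In the first, \<open>E\<close> is at least 3 and outweighs the
  cosine; in the second, the cosine term has the favourable sign.\<close>

lemma norm_sin_ge_exp:
  fixes z :: complex
  assumes "\<bar>Im z\<bar> \<ge> 1 \<or> cos (2 * Re z) = -1"
  shows "norm (sin z) \<ge> exp \<bar>Im z\<bar> / 4"
proof (rule power2_le_imp_le)
  define E where "E = exp (2 * \<bar>Im z\<bar>)"
  have s: "exp (2 * Im z) + inverse (exp (2 * Im z)) = E + inverse E"
    by (cases "Im z \<ge> 0") (simp_all add: E_def exp_minus)
  have E: "E > 0" by (simp add: E_def)
  have "(exp \<bar>Im z\<bar> / 4) ^ 2 = E / 16"
    by (simp add: E_def power_divide exp_of_nat_mult[of 2, simplified, symmetric])
  also have "\<dots> \<le> (E + inverse E - 2 * cos (2 * Re z)) / 4"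
    using assms
  proof
    assume "\<bar>Im z\<bar> \<ge> 1"
    hence "E \<ge> 1 + 2" unfolding E_def by (intro order.trans[OF _ exp_ge_add_one_self]) auto
    moreover obtain F where F: "F = inverse E" "F > 0" using E by simp
    moreover obtain c where c: "c = cos (2 * Re z)" "c \<le> 1" by simp
    ultimately show ?thesis unfolding F(1)[symmetric] c(1)[symmetric] by simp
  next
    assume "cos (2 * Re z) = -1"
    moreover obtain F where F: "F = inverse E" "F > 0" using E by simp
    ultimately show ?thesis unfolding F(1)[symmetric] using E by simp
  qed
  also have "\<dots> = norm (sin z) ^ 2" unfolding norm_sin_squared s ..
  finally show "(exp \<bar>Im z\<bar> / 4) ^ 2 \<le> norm (sin z) ^ 2" .
qed auto

text \<open>The \<open>m\<close> factors \<open>sin (\<pi> w / m)\<close> together contribute at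
  most \<open>exp (\<pi> |Im w|)\<close>, and the sine in the denominator is at least a quarter of
  that. The exponentials cancel and a constant bound remains.\<close>

lemma norm_moment_fun_minus_le:
  assumes "m > 0" "Re w \<ge> 1 / 2" "\<bar>Im w\<bar> \<ge> 1 \<or> (\<exists>L::nat. Re w = real L + 1 / 2)"
  shows "norm (moment_fun m (- w)) \<le> 4 * pi * norm (gamma_power_ratio m (of_real (1/2)))"
proof -
  have "\<bar>Im (of_real pi * w)\<bar> \<ge> 1 \<or> cos (2 * Re (of_real pi * w)) = -1"
    using assms(3)
  proof
    assume "\<bar>Im w\<bar> \<ge> 1"
    hence "\<bar>Im w\<bar> * pi \<ge> 1 * 1" using pi_ge_two by (intro mult_mono) auto
    thus ?thesis by (simp add: abs_mult mult.commute)
  next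
    assume "\<exists>L::nat. Re w = real L + 1 / 2"
    then obtain L where L: "Re w = real L + 1 / 2" by auto
    have e: "2 * Re (of_real pi * w) = pi + 2 * real L * pi" using L by (simp add: algebra_simps)
    have "cos (pi + 2 * real L * pi) = -1" unfolding cos_add cos_2npi sin_2npi by simp
    thus ?thesis unfolding e by simp
  qed
  hence s: "norm (sin (of_real pi * w)) \<ge> exp (pi * \<bar>Im w\<bar>) / 4"
    using norm_sin_ge_exp[of "of_real pi * w"] by (simp add: abs_mult)
  have "exp (pi * \<bar>Im w\<bar>) / 4 > 0" by simp
  hence s0: "norm (sin (of_real pi * w)) > 0" using s by linarith
  have sm: "norm (sin (of_real pi * (w / of_nat m)) ^ m) \<le> exp (pi * \<bar>Im w\<bar>)"
  proof -
    have "norm (sin (of_real pi * (w / of_nat m))) ^ m \<le> exp \<bar>Im (of_real pi * (w / of_nat m))\<bar> ^ m"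
      by (intro power_mono norm_sin_le_exp) auto
    also have "\<dots> = exp (real m * (pi * \<bar>Im w\<bar> / real m))"
      by (subst exp_of_nat_mult) (simp add: abs_mult)
    also have "\<dots> = exp (pi * \<bar>Im w\<bar>)" using assms by simp
    finally show ?thesis by (simp add: norm_power)
  qed
  have "rGamma (1 - w) \<noteq> 0"
    using rGamma_reflection_complex[of w] s0 by (auto simp: rGamma_inverse_Gamma)
  hence "moment_fun m (- w) * sin (of_real pi * w) =
    gamma_power_ratio m w * sin (of_real pi * (w / of_nat m)) ^ m * of_real pi / of_real pi ^ m"
    using assms by (intro moment_fun_minus) auto
  from arg_cong[OF this, of norm]
  have "norm (moment_fun m (-w)) * norm (sin (of_real pi * w)) =
    norm (gamma_power_ratio m w) * norm (sin (of_real pi * (w / of_nat m)) ^ m) * (pi / pi ^ m)"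
    unfolding norm_mult norm_divide by (simp add: norm_power)
  also have "\<dots> \<le> norm (gamma_power_ratio m (of_real (1/2))) * exp (pi * \<bar>Im w\<bar>) * (pi / 1)"
    using assms sm pi_ge_two
    by (intro mult_mono norm_gamma_power_ratio_le divide_left_mono one_le_power mult_nonneg_nonneg) auto
  also have "\<dots> = 4 * pi * norm (gamma_power_ratio m (of_real (1/2))) * (exp (pi * \<bar>Im w\<bar>) / 4)" by simp
  also have "\<dots> \<le> 4 * pi * norm (gamma_power_ratio m (of_real (1/2))) * norm (sin (of_real pi * w))"
    by (intro mult_left_mono s) auto
  finally show ?thesis using s0 by (simp add: mult_le_cancel_right)
qed

section \<open>Residues and the contour integral\<close>

text \<open>The residue of \<open>moment_fun m\<close> at \<open>- (j + 1)\<close>, already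
  rewritten by reflection so that the power of the sine can be expanded in roots of unity.\<close>

definition moment_residue :: "nat \<Rightarrow> nat \<Rightarrow> complex" where
  "moment_residue m j = (- 1) ^ j * gamma_power_ratio m (of_nat (Suc j)) *
     sin (of_real pi * (of_nat (Suc j) / of_nat m)) ^ m / of_real pi ^ m"

lemma moment_residueidue_limit:
  assumes "m > 0"
  shows "((\<lambda>z. moment_fun m z * (z - (- of_nat (Suc j)))) \<longlongrightarrow> moment_residue m j) (at (- of_nat (Suc j)))"
proof -
  have np: "v \<notin> \<int>\<^sub>\<le>\<^sub>0" if "Re v > 0" for v
    using that by (auto elim!: nonpos_Ints_cases)
  define x where "x = (of_nat (Suc j) / of_nat m :: complex)"
  have "Re x > 0" using assms by (simp add: x_def)
  hence G: "Gamma x \<noteq> 0"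
    using assms by (simp add: Gamma_eq_zero_iff np)
  have r1: "rGamma (1 - x) = Gamma x * sin (of_real pi * x) / of_real pi"
    using rGamma_reflection_complex[of x] G
    by (simp add: rGamma_inverse_Gamma[of x] divide_simps mult_ac split: if_splits)
  have "((\<lambda>z. Gamma z * (z + of_nat j)) \<longlongrightarrow> (- 1) ^ j / fact j) (at (- of_nat j :: complex))"
    by (rule Gamma_residues)
  note LIM_offset[OF this, of 1]
  moreover have "- of_nat j - 1 = (- of_nat (Suc j) :: complex)" by simp
  ultimately have l1: "((\<lambda>z. Gamma (z + 1) * (z + 1 + of_nat j)) \<longlongrightarrow> (- 1) ^ j / fact j) (at (- of_nat (Suc j) :: complex))"
    by (simp only:)
  have "(\<lambda>z. rGamma (z / of_nat m + 1) ^ m * exp (- z * of_real (ln (real m)))) holomorphic_on UNIV"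
    using assms by (intro holomorphic_intros) auto
  hence "isCont (\<lambda>z. rGamma (z / of_nat m + 1) ^ m * exp (- z * of_real (ln (real m)))) (- of_nat (Suc j) :: complex)"
    by (meson UNIV_I continuous_on_eq_continuous_at holomorphic_on_imp_continuous_on open_UNIV)
  from tendsto_mult[OF l1 this[unfolded isCont_def]]
  have "((\<lambda>z :: complex. (Gamma (z + 1) * (z + 1 + of_nat j)) * rGamma (z / of_nat m + 1) ^ m * exp (- z * of_real (ln (real m)))) \<longlongrightarrow>
      (- 1) ^ j / fact j * rGamma (- of_nat (Suc j) / of_nat m + 1) ^ m * exp (- (- of_nat (Suc j)) * of_real (ln (real m))))
      (at (- of_nat (Suc j)))" by (simp only: mult.assoc)
  also have "(\<lambda>z. (Gamma (z + 1) * (z + 1 + of_nat j)) * rGamma (z / of_nat m + 1) ^ m * exp (- z * of_real (ln (real m)))) =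
      (\<lambda>z. moment_fun m z * (z - (- of_nat (Suc j))))"
    by (auto simp: moment_fun_def algebra_simps)
  also have "(- 1) ^ j / fact j * rGamma (- of_nat (Suc j) / of_nat m + 1) ^ m * exp (- (- of_nat (Suc j)) * of_real (ln (real m))) = moment_residue m j"
  proof -
    have "- of_nat (Suc j) / of_nat m + 1 = 1 - x" by (simp add: x_def del: of_nat_Suc)
    moreover have "rGamma (of_nat (Suc j)) = (1 / fact j :: complex)"
      by (simp add: rGamma_inverse_Gamma Gamma_fact divide_inverse)
    ultimately show ?thesis
      by (simp add: r1 moment_residue_def gamma_power_ratio_def power_divide power_mult_distrib x_def[symmetric] del: of_nat_Suc)
  qed
  finally show ?thesis .
qed

lemma norm_moment_residue_le:
  assumes "m > 0"
  shows "norm (moment_residue m j) \<le> norm (gamma_power_ratio m (of_real (1/2)))"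
proof -
  have "norm (moment_residue m j) = norm (gamma_power_ratio m (of_nat (Suc j))) *
     norm (sin (complex_of_real (pi * (real (Suc j) / real m)))) ^ m / pi ^ m"
    by (simp add: moment_residue_def norm_mult norm_divide norm_power)
  also have "\<dots> \<le> norm (gamma_power_ratio m (of_real (1/2))) * 1 ^ m / 1"
    using assms pi_ge_two unfolding sin_of_real norm_of_real
    by (intro frac_le mult_mono power_mono norm_gamma_power_ratio_le one_le_power mult_nonneg_nonneg) (auto)
  finally show ?thesis by simp
qed

lemma norm_contour_integral_rectpath_le:
  assumes "Re a \<le> Re b" "Im a \<le> Im b" "continuous_on (path_image (rectpath a b)) f"
    and "\<And>z. z \<in> path_image (rectpath a b) \<Longrightarrow> norm (f z) \<le> B"
  shows "norm (contour_integral (rectpath a b) f) \<le> 2 * B * ((Re b - Re a) + (Im b - Im a))"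
proof -
  define a2 a4 where "a2 = Complex (Re b) (Im a)" and "a4 = Complex (Re a) (Im b)"
  have r: "rectpath a b = linepath a a2 +++ linepath a2 b +++ linepath b a4 +++ linepath a4 a"
    by (simp add: rectpath_def Let_def a2_def a4_def)
  have pi: "path_image (rectpath a b) = closed_segment a a2 \<union> closed_segment a2 b \<union> closed_segment b a4 \<union> closed_segment a4 a"
    unfolding r by (simp add: path_image_join Un_assoc)
  have ci: "f contour_integrable_on linepath p q" if "closed_segment p q \<subseteq> path_image (rectpath a b)" for p q
    using that assms(3) by (intro contour_integrable_continuous_linepath) (auto intro: continuous_on_subset)
  have bd: "norm (contour_integral (linepath p q) f) \<le> B * norm (q - p)" if "closed_segment p q \<subseteq> path_image (rectpath a b)" for p q
  proof (rule contour_integral_bound_linepath[OF ci[OF that]])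
    have "norm (f p) \<le> B" using that assms(4) by auto
    thus "0 \<le> B" using norm_ge_zero order.trans by blast
  qed (use that assms(4) in auto)
  have sub: "closed_segment a a2 \<subseteq> path_image (rectpath a b)" "closed_segment a2 b \<subseteq> path_image (rectpath a b)"
     "closed_segment b a4 \<subseteq> path_image (rectpath a b)" "closed_segment a4 a \<subseteq> path_image (rectpath a b)"
    unfolding pi by auto
  have "contour_integral (rectpath a b) f = contour_integral (linepath a a2) f + contour_integral (linepath a2 b) f
     + contour_integral (linepath b a4) f + contour_integral (linepath a4 a) f"
    unfolding r using ci sub by (simp add: contour_integrable_joinI)
  also have "norm \<dots> \<le> B * norm (a2 - a) + B * norm (b - a2) + B * norm (a4 - b) + B * norm (a - a4)"
    by (intro order.trans[OF norm_triangle_ineq] add_mono bd sub)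
  also have "norm (a2 - a) = Re b - Re a" using assms(1) by (simp add: a2_def cmod_def)
  also have "norm (b - a2) = Im b - Im a" using assms(2) by (simp add: a2_def cmod_def)
  also have "norm (a4 - b) = Re b - Re a" using assms(1) by (simp add: a4_def cmod_def)
  also have "norm (a - a4) = Im b - Im a" using assms(2) by (simp add: a4_def cmod_def)
  finally show ?thesis by (simp add: algebra_simps)
qed

lemma moment_fun_holomorphic:
  assumes "m > 0" "\<And>n. - of_nat (Suc n) \<notin> A"
  shows "moment_fun m holomorphic_on A"
proof -
  have "z + 1 \<notin> \<int>\<^sub>\<le>\<^sub>0" if "z \<in> A" for z
  proof
    assume "z + 1 \<in> \<int>\<^sub>\<le>\<^sub>0"
    then obtain n where "z + 1 = - of_nat n" by (auto elim!: nonpos_Ints_cases')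
    hence "z = - of_nat (Suc n)" by (metis add_diff_cancel_right' minus_add_distrib of_nat_Suc uminus_add_conv_diff add.commute)
    thus False using that assms(2) by blast
  qed
  moreover have "moment_fun m = (\<lambda>z. Gamma (z + 1) * rGamma (z / of_nat m + 1) ^ m * exp (- z * of_real (ln (real m))))"
    by (simp add: moment_fun_def fun_eq_iff)
  ultimately show ?thesis using assms(1) by (auto intro!: holomorphic_intros)
qed

text \<open>The residue theorem for \<open>f\<close> on growing rectangles. Since
  \<open>moment_fun\<close> is only known to be bounded there and the perimeter grows like
  \<open>L\<close>, one linear denominator would not force the integral to 0; two give a bound of
  order \<open>1 / L\<close>. The price is that only differences of values are reached.\<close>

lemma moment_fun_partial_fractions:
  fixes s t :: nat
  assumes m: "m > 0" and st: "s \<noteq> t"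
  shows "(\<lambda>j. moment_residue m j / ((of_nat (Suc j) + of_nat s) * (of_nat (Suc j) + of_nat t))) sums
           ((moment_fun m (of_nat s) - moment_fun m (of_nat t)) / (of_nat t - of_nat s))"
proof -
  define f where "f = (\<lambda>z. moment_fun m z / ((z - of_nat s) * (z - of_nat t)))"
  define K where "K = norm (moment_fun m (of_real (-1/2))) + 4 * pi * norm (gamma_power_ratio m (of_real (1/2)))"
  \<comment> \<open>The left side runs midway between the poles \<open>- L\<close> and
    \<open>- (L + 1)\<close>.\<close>
  define a where "a = (\<lambda>L. Complex (- (real L + 1/2)) (- (real L + 1)))"
  define b where "b = (\<lambda>L. Complex (real L + 1) (real L + 1))"
  define g where "g = (\<lambda>j. moment_residue m j / ((of_nat (Suc j) + of_nat s) * (of_nat (Suc j) + of_nat t)))"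
  define R where "R = (moment_fun m (of_nat s) - moment_fun m (of_nat t)) / (of_nat s - of_nat t)"
  have snt: "(of_nat s :: complex) \<noteq> of_nat t" using st by simp
  have K: "K \<ge> 0" by (simp add: K_def)
  have main: "contour_integral (rectpath (a L) (b L)) f = 2 * pi * \<i> * (R + (\<Sum>j<L. g j)) \<and>
     norm (contour_integral (rectpath (a L) (b L)) f) \<le> 2 * (4 * K / real L ^ 2) * (4 * real L + 7/2)"
    if L: "L \<ge> 2 * s + 2 * t + 2" for L
  proof
    \<comment> \<open>A half-plane containing exactly the first \<open>L\<close> poles, all of which
      lie in the rectangle.\<close>
    define S where "S = {z :: complex. Re z > - (real L + 1)}"
    define P where "P = (\<lambda>j. - of_nat (Suc j) :: complex) ` {..<L}"
    define pts where "pts = {of_nat s, of_nat t} \<union> P"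
    have Lr: "real L \<ge> 2 * real s + 2 * real t + 2" using L by linarith
    have ab: "Re (a L) \<le> Re (b L)" "Im (a L) \<le> Im (b L)" by (auto simp: a_def b_def)
    have holM: "moment_fun m holomorphic_on (S - P)"
    proof (rule moment_fun_holomorphic[OF m])
      fix n show "- of_nat (Suc n) \<notin> S - P"
        by (cases "n < L") (auto simp: S_def P_def)
    qed
    have holf: "f holomorphic_on (S - pts)"
      unfolding f_def using snt
      by (intro holomorphic_intros holomorphic_on_subset[OF holM]) (auto simp: pts_def)
    have oS: "open S" unfolding S_def by (rule open_halfspace_Re_gt)
    have pi: "z \<in> path_image (rectpath (a L) (b L)) \<longleftrightarrow>
       (Re z \<in> {- (real L + 1/2), real L + 1} \<and> \<bar>Im z\<bar> \<le> real L + 1) \<or>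
       (\<bar>Im z\<bar> = real L + 1 \<and> - (real L + 1/2) \<le> Re z \<and> Re z \<le> real L + 1)" for z
      by (subst path_image_rectpath[OF ab]) (auto simp: a_def b_def)
    have sub: "path_image (rectpath (a L) (b L)) \<subseteq> S - pts"
    proof
      fix z assume z: "z \<in> path_image (rectpath (a L) (b L))"
      have "z \<in> S" using z by (auto simp: pi S_def)
      moreover have "z \<notin> pts"
      proof
        assume "z \<in> pts"
        hence "(\<exists>k::nat. z = of_nat k \<and> k \<le> L) \<or> (\<exists>k::nat. z = - of_nat k \<and> 0 < k \<and> k \<le> L)"
          using L by (auto simp: pts_def P_def simp del: of_nat_Suc)
        then obtain k :: int where k: "z = of_int k" "\<bar>k\<bar> \<le> int L"
          by (metis abs_minus_cancel abs_of_nat of_int_minus of_int_of_nat_eq of_nat_le_iff)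
        have kL: "\<bar>real_of_int k\<bar> \<le> real L" using k(2) by linarith
        have "Im z = 0" "Re z = of_int k" by (simp_all add: k(1))
        hence "real_of_int k = - (real L + 1/2)" using z kL by (auto simp: pi)
        thus False using kL by linarith
      qed
      ultimately show "z \<in> S - pts" by auto
    qed
    have inbox: "p \<in> box (a L) (b L)" if "p \<in> pts" for p
      using that Lr by (auto simp: pts_def P_def in_box_complex_iff a_def b_def)
    have Rf: "residue f (of_nat s) = moment_fun m (of_nat s) / (of_nat s - of_nat t)"
             "residue f (of_nat t) = moment_fun m (of_nat t) / (of_nat t - of_nat s)"
    proof -
      have *: "residue (\<lambda>z. (moment_fun m z / (z - of_nat v)) / (z - of_nat u)) (of_nat u) = moment_fun m (of_nat u) / (of_nat u - of_nat v)"
        if "u \<noteq> v" for u v :: nat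
      proof (rule residue_simple)
        show "open ({z. Re z > - 1} - {complex_of_nat v})"
          by (intro open_Diff open_halfspace_Re_gt) auto
        show "of_nat u \<in> {z. Re z > - 1} - {complex_of_nat v}" using that by auto
        show "(\<lambda>z. moment_fun m z / (z - of_nat v)) holomorphic_on ({z. Re z > - 1} - {complex_of_nat v})"
          by (intro holomorphic_intros moment_fun_holomorphic m) auto
      qed
      show "residue f (of_nat s) = moment_fun m (of_nat s) / (of_nat s - of_nat t)"
        using *[OF st] by (simp add: f_def mult.commute)
      show "residue f (of_nat t) = moment_fun m (of_nat t) / (of_nat t - of_nat s)"
        using *[OF st[symmetric]] by (simp add: f_def)
    qed
    have Rg: "residue f (- of_nat (Suc j)) = g j" for j
    proof (rule residue_simple')
      show "open (ball (- of_nat (Suc j)) 1 :: complex set)" by simp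
      \<comment> \<open>In this ball an integral real part can only be that of the centre, so the
        ball contains no other pole and neither \<open>s\<close> nor \<open>t\<close>.\<close>
      have ri: "Re z = - real (Suc j)" if "z \<in> ball (- of_nat (Suc j)) 1" "Re z = real_of_int k" for z :: complex and k
      proof -
        have "\<bar>Re (- of_nat (Suc j) - z)\<bar> < 1" using that abs_Re_le_cmod[of "- of_nat (Suc j) - z"] by (simp add: dist_norm)
        hence "\<bar>- real (Suc j) - real_of_int k\<bar> < 1" using that(2) by simp
        hence "\<bar>- int (Suc j) - k\<bar> < 1" by linarith
        thus ?thesis using that(2) by simp
      qed
      show "f holomorphic_on (ball (- of_nat (Suc j)) 1 - {- of_nat (Suc j)})"
        unfolding f_def
      proof (intro holomorphic_intros moment_fun_holomorphic m)
        fix n show "- of_nat (Suc n) \<notin> ball (- of_nat (Suc j)) 1 - {- of_nat (Suc j) :: complex}"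
          using ri[of "- of_nat (Suc n)" "- int (Suc n)"] by auto
      next
        fix z assume z: "z \<in> ball (- of_nat (Suc j)) 1 - {- of_nat (Suc j) :: complex}"
        have "z \<noteq> of_nat u" for u using ri[of z "int u"] z by auto
        thus "(z - of_nat s) * (z - of_nat t) \<noteq> 0" by simp
      qed
      have ne: "- of_nat (Suc j) \<noteq> (of_nat u :: complex)" for u
      proof
        assume "- of_nat (Suc j) = (of_nat u :: complex)"
        from arg_cong[OF this, of Re] show False by simp
      qed
      have "((\<lambda>z. (moment_fun m z * (z - (- of_nat (Suc j)))) / ((z - of_nat s) * (z - of_nat t))) \<longlongrightarrow>
         moment_residue m j / ((- of_nat (Suc j) - of_nat s) * (- of_nat (Suc j) - of_nat t))) (at (- of_nat (Suc j)))"
        using ne[of s] ne[of t] by (intro tendsto_intros moment_residueidue_limit m) (simp del: of_nat_Suc)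
      moreover have "(- of_nat (Suc j) - of_nat s) * (- of_nat (Suc j) - of_nat t) =
         (of_nat (Suc j) + of_nat s) * (of_nat (Suc j) + of_nat t :: complex)" by (simp add: algebra_simps)
      ultimately show "((\<lambda>w. f w * (w - - of_nat (Suc j))) \<longlongrightarrow> g j) (at (- of_nat (Suc j)))"
        by (simp add: f_def g_def del: of_nat_Suc)
    qed auto
    have "contour_integral (rectpath (a L) (b L)) f = 2 * pi * \<i> * (\<Sum>p\<in>pts. winding_number (rectpath (a L) (b L)) p * residue f p)"
    proof (rule Residue_theorem[OF oS _ _ holf])
      show "connected S" unfolding S_def by (intro convex_connected convex_halfspace_Re_gt)
      show "finite pts" by (simp add: pts_def P_def)
      show "\<forall>z. z \<notin> S \<longrightarrow> winding_number (rectpath (a L) (b L)) z = 0"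
        by (intro allI impI winding_number_rectpath_outside ab) (auto simp: S_def in_cbox_complex_iff a_def)
    qed (use sub in auto)
    also have "(\<Sum>p\<in>pts. winding_number (rectpath (a L) (b L)) p * residue f p) = (\<Sum>p\<in>pts. residue f p)"
      by (intro sum.cong) (simp_all add: winding_number_rectpath inbox)
    also have "\<dots> = (\<Sum>p\<in>{of_nat s, of_nat t}. residue f p) + (\<Sum>p\<in>P. residue f p)"
      unfolding pts_def
    proof (rule sum.union_disjoint)
      show "{of_nat s, of_nat t} \<inter> P = {}"
      proof -
        have "of_nat u \<noteq> (- of_nat (Suc j) :: complex)" for u j
        proof
          assume "(of_nat u :: complex) = - of_nat (Suc j)"
          from arg_cong[OF this, of Re] show False by simp
        qed
        thus ?thesis unfolding P_def by blast
      qed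
    qed (auto simp: P_def)
    also have "(\<Sum>p\<in>P. residue f p) = (\<Sum>j<L. g j)"
      unfolding P_def by (subst sum.reindex) (auto simp: inj_on_def Rg simp del: of_nat_Suc)
    also have "(\<Sum>p\<in>{of_nat s, of_nat t}. residue f p) = R"
    proof -
      have "moment_fun m (of_nat t) / (of_nat t - of_nat s) = - (moment_fun m (of_nat t) / (of_nat s - of_nat t))"
        by (metis minus_diff_eq minus_divide_right)
      thus ?thesis using snt by (simp add: Rf R_def diff_divide_distrib)
    qed
    finally show "contour_integral (rectpath (a L) (b L)) f = 2 * pi * \<i> * (R + (\<Sum>j<L. g j))" .
    have bd: "norm (f z) \<le> 4 * K / real L ^ 2" if z: "z \<in> path_image (rectpath (a L) (b L))" for z
    proof -
      have M: "norm (moment_fun m z) \<le> K"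
      proof (cases "Re z \<ge> -1/2")
        case True
        hence "norm (moment_fun m z) \<le> norm (moment_fun m (of_real (-1/2)))" by (intro norm_moment_fun_le m) auto
        thus ?thesis by (simp add: K_def add_increasing2)
      next
        case False
        have "\<bar>Im z\<bar> \<ge> 1 \<or> Re z = - (real L + 1/2)" using z False by (auto simp: pi)
        hence "norm (moment_fun m (- (- z))) \<le> 4 * pi * norm (gamma_power_ratio m (of_real (1/2)))"
          using False m by (intro norm_moment_fun_minus_le) auto
        thus ?thesis by (simp add: K_def add_increasing)
      qed
      \<comment> \<open>By the choice of \<open>L\<close>, \<open>u\<close> is at most
        \<open>L / 2 - 1\<close>, so all four sides are at distance at least
        \<open>L / 2\<close>.\<close>
      have d: "norm (z - of_nat u) \<ge> real L / 2" if "u \<le> s + t" for u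
      proof -
        have "real u \<le> real s + real t" using that by linarith
        hence "\<bar>Re (z - of_nat u)\<bar> \<ge> real L / 2 \<or> \<bar>Im (z - of_nat u)\<bar> \<ge> real L / 2"
          using z Lr by (auto simp: pi)
        thus ?thesis using abs_Re_le_cmod[of "z - of_nat u"] abs_Im_le_cmod[of "z - of_nat u"] by linarith
      qed
      have "norm (f z) = norm (moment_fun m z) / (norm (z - of_nat s) * norm (z - of_nat t))"
        by (simp add: f_def norm_divide norm_mult)
      also have "\<dots> \<le> K / ((real L / 2) * (real L / 2))"
        using Lr by (intro frac_le M K mult_mono d mult_pos_pos) auto
      also have "\<dots> = 4 * K / real L ^ 2" by (simp add: power2_eq_square)
      finally show ?thesis .
    qed
    have "norm (contour_integral (rectpath (a L) (b L)) f) \<le> 2 * (4 * K / real L ^ 2) * ((Re (b L) - Re (a L)) + (Im (b L) - Im (a L)))"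
      by (intro norm_contour_integral_rectpath_le ab bd holomorphic_on_imp_continuous_on holomorphic_on_subset[OF holf] sub)
    thus "norm (contour_integral (rectpath (a L) (b L)) f) \<le> 2 * (4 * K / real L ^ 2) * (4 * real L + 7/2)"
      by (simp add: a_def b_def algebra_simps)
  qed
  have ev: "eventually (\<lambda>L. norm (contour_integral (rectpath (a L) (b L)) f) \<le> 2 * (4 * K / real L ^ 2) * (4 * real L + 7/2)) sequentially"
    using eventually_ge_at_top[of "2 * s + 2 * t + 2"] by eventually_elim (use main in blast)
  have "(\<lambda>L. 2 * (4 * K / real L ^ 2) * (4 * real L + 7/2)) \<longlonglongrightarrow> 0" by real_asymp
  from tendsto_norm_zero_cancel[OF tendsto_sandwich[OF _ ev tendsto_const this]]
  have "(\<lambda>L. contour_integral (rectpath (a L) (b L)) f) \<longlonglongrightarrow> 0" by simp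
  moreover have "eventually (\<lambda>L. contour_integral (rectpath (a L) (b L)) f = 2 * pi * \<i> * (R + (\<Sum>j<L. g j))) sequentially"
    using eventually_ge_at_top[of "2 * s + 2 * t + 2"] by eventually_elim (use main in blast)
  ultimately have "(\<lambda>L. 2 * pi * \<i> * (R + (\<Sum>j<L. g j))) \<longlonglongrightarrow> 0" by (rule Lim_transform_eventually)
  from tendsto_diff[OF tendsto_mult[OF tendsto_const[of "1 / (2 * pi * \<i>)"] this] tendsto_const[of R]]
  have "(\<lambda>L. (\<Sum>j<L. g j)) \<longlonglongrightarrow> - R" by simp
  moreover have "- R = (moment_fun m (of_nat s) - moment_fun m (of_nat t)) / (of_nat t - of_nat s)"
    by (metis R_def minus_diff_eq minus_divide_right)
  ultimately show ?thesis by (simp add: sums_def g_def)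
qed

section \<open>Continuation to a half-plane\<close>

text \<open>Pairs a coefficient sequence with a continuation of its sum beyond the unit disc, so
  that operations on sequences can be tracked on the continued function.\<close>

definition halfplane_series :: "(nat \<Rightarrow> complex) \<Rightarrow> (complex \<Rightarrow> complex) \<Rightarrow> bool" where
  "halfplane_series a H \<longleftrightarrow> H holomorphic_on {v. Re v < 1} \<and> (\<forall>v. norm v < 1 \<longrightarrow> (\<lambda>j. a j * v ^ j) sums H v)"

lemma halfplane_series_geometric: "halfplane_series (\<lambda>_. 1) (\<lambda>v. 1 / (1 - v))"
  unfolding halfplane_series_def by (auto intro!: holomorphic_intros geometric_sums)

lemma halfplane_series_cmult:
  "halfplane_series a H \<Longrightarrow> halfplane_series (\<lambda>j. c * a j) (\<lambda>v. c * H v)"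
  unfolding halfplane_series_def by (auto intro!: holomorphic_intros sums_mult simp: mult.assoc)

lemma norm_less_one_Re: "norm v < 1 \<Longrightarrow> Re v < 1"
  using complex_Re_le_cmod[of v] by linarith

text \<open>The operator \<open>v d/dv + \<alpha>\<close> multiplies \<open>v ^ j\<close> by
  \<open>j + \<alpha>\<close>.\<close>

lemma halfplane_series_euler:
  assumes "halfplane_series a H"
  shows "halfplane_series (\<lambda>j. (of_nat j + \<alpha>) * a j) (\<lambda>v. v * deriv H v + \<alpha> * H v)"
  unfolding halfplane_series_def
proof (intro conjI allI impI)
  have hol: "H holomorphic_on {v. Re v < 1}" and s: "\<And>v. norm v < 1 \<Longrightarrow> (\<lambda>j. a j * v ^ j) sums H v"
    using assms by (auto simp: halfplane_series_def)
  show "(\<lambda>v. v * deriv H v + \<alpha> * H v) holomorphic_on {v. Re v < 1}"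
    using hol by (intro holomorphic_intros holomorphic_deriv open_halfspace_Re_lt)
  fix v :: complex assume v: "norm v < 1"
  obtain r where r: "norm v < r" "r < 1" using v dense by blast
  have r0: "r > 0" using r(1) norm_ge_zero[of v] by linarith
  have sr: "summable (\<lambda>n. a n * of_real r ^ n)" using s[of "of_real r"] r r0 by (auto simp: sums_iff)
  have d: "((\<lambda>x. \<Sum>n. a n * x ^ n) has_field_derivative (\<Sum>n. diffs a n * v ^ n)) (at v)"
    using r r0 by (intro termdiffs_strong[OF sr]) auto
  have "((\<lambda>x. \<Sum>n. a n * x ^ n) has_field_derivative deriv H v) (at v)"
  proof (rule has_field_derivative_transform_within_open)
    show "(H has_field_derivative deriv H v) (at v)"
      using hol v by (intro holomorphic_derivI[OF _ open_halfspace_Re_lt]) (auto simp: norm_less_one_Re)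
    show "H x = (\<Sum>n. a n * x ^ n)" if "x \<in> ball 0 1" for x
      using s[of x] that by (simp add: sums_iff)
  qed (use v in auto)
  with d have dv: "deriv H v = (\<Sum>n. diffs a n * v ^ n)" by (rule DERIV_unique[symmetric])
  have "summable (\<lambda>n. diffs a n * v ^ n)"
  proof (rule termdiff_converges[of _ r])
    show "norm v < r" by fact
    fix x :: complex assume "norm x < r"
    thus "summable (\<lambda>n. a n * x ^ n)" using s[of x] r by (auto simp: sums_iff)
  qed
  hence "(\<lambda>n. v * (diffs a n * v ^ n)) sums (v * deriv H v)" unfolding dv by (intro sums_mult summable_sums)
  hence "(\<lambda>n. of_nat (Suc n) * a (Suc n) * v ^ Suc n) sums (v * deriv H v)" by (simp add: diffs_def mult_ac)
  hence "(\<lambda>n. of_nat n * a n * v ^ n) sums (v * deriv H v)" by (subst (asm) sums_Suc_iff) auto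
  from sums_add[OF this sums_mult[OF s[OF v], of \<alpha>]]
  show "(\<lambda>j. (of_nat j + \<alpha>) * a j * v ^ j) sums (v * deriv H v + \<alpha> * H v)"
    by (simp add: algebra_simps)
qed

text \<open>Multiplying \<open>v ^ j\<close> by the \<open>j\<close>-th moment averages
  \<open>(v y) ^ j\<close>. The half-plane is star-shaped about 0, so \<open>v y\<close> stays in it
  for \<open>y\<close> in \<open>[0, 1]\<close> and the average of \<open>H\<close> is again
  holomorphic there.\<close>

lemma halfplane_series_hadamard:
  fixes y \<phi> :: "real \<Rightarrow> real"
  assumes H: "halfplane_series a H"
    and y: "continuous_on {0..1} y" "\<And>t. t \<in> {0..1} \<Longrightarrow> y t \<in> {0..1}"
    and \<phi>: "continuous_on {0..1} \<phi>"
  shows "halfplane_series (\<lambda>j. of_real (integral {0..1} (\<lambda>t. y t ^ j * \<phi> t)) * a j)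
           (\<lambda>v. integral {0..1} (\<lambda>t. H (v * of_real (y t)) * of_real (\<phi> t)))"
  unfolding halfplane_series_def
proof (intro conjI allI impI)
  let ?U = "{v. Re v < 1}"
  have hol: "H holomorphic_on ?U" and s: "\<And>v. norm v < 1 \<Longrightarrow> (\<lambda>j. a j * v ^ j) sums H v"
    using H by (auto simp: halfplane_series_def)
  have oU: "open ?U" by (rule open_halfspace_Re_lt)
  have star: "v * of_real (y t) \<in> ?U" if "v \<in> ?U" "t \<in> {0..1}" for v t
  proof -
    have "Re v * y t \<le> max 0 (Re v) * 1" using y(2)[OF that(2)] by (intro mult_mono) auto
    thus ?thesis using that by simp
  qed
  have cH: "continuous_on ?U H" "continuous_on ?U (deriv H)"
    using hol holomorphic_deriv[OF hol oU] by (auto intro: holomorphic_on_imp_continuous_on)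
  have int: "(\<lambda>t. H (v * of_real (y t)) * of_real (\<phi> t)) integrable_on {0..1}" if "v \<in> ?U" for v
    using star that by (intro integrable_continuous_interval continuous_intros \<phi> y
        continuous_on_compose2[OF cH(1)]) auto
  show "(\<lambda>v. integral {0..1} (\<lambda>t. H (v * of_real (y t)) * of_real (\<phi> t))) holomorphic_on ?U"
    unfolding cbox_interval[symmetric]
  proof (rule leibniz_rule_holomorphic)
    fix v t assume vt: "v \<in> ?U" "t \<in> cbox 0 (1::real)"
    have "(H has_field_derivative deriv H (v * of_real (y t))) (at (v * of_real (y t)))"
      using hol star[of v t] vt by (intro holomorphic_derivI[OF _ oU]) auto
    hence "((\<lambda>v. H (v * of_real (y t))) has_field_derivative deriv H (v * of_real (y t)) * of_real (y t)) (at v within ?U)"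
      by (rule DERIV_chain2) (auto intro!: derivative_eq_intros)
    thus "((\<lambda>v. H (v * of_real (y t)) * of_real (\<phi> t)) has_field_derivative
        deriv H (v * of_real (y t)) * of_real (y t) * of_real (\<phi> t)) (at v within ?U)"
      by (auto intro!: derivative_eq_intros)
  next
    show "continuous_on (?U \<times> cbox 0 (1::real)) (\<lambda>(v, t). deriv H (v * of_real (y t)) * of_real (y t) * of_real (\<phi> t))"
      unfolding case_prod_unfold
      using star by (intro continuous_intros continuous_on_compose2[OF cH(2)] continuous_on_compose2[OF \<phi>]
           continuous_on_compose2[OF y(1)]) auto
    show "convex ?U" by (rule convex_halfspace_Re_lt)
  qed (use int in auto)
  fix v :: complex assume v: "norm v < 1"
  obtain r where r: "norm v < r" "r < 1" using v dense by blast
  have r0: "r > 0" using r(1) norm_ge_zero[of v] by linarith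
  have sm: "summable (\<lambda>n. norm (a n * v ^ n))"
  proof (rule powser_insidea)
    show "summable (\<lambda>n. a n * of_real r ^ n)" using s[of "of_real r"] r r0 by (auto simp: sums_iff)
  qed (use r r0 in auto)
  obtain B where B: "\<And>t. t \<in> {0..1} \<Longrightarrow> \<bar>\<phi> t\<bar> \<le> B"
    using compact_continuous_image[OF \<phi>] compact_imp_bounded
    by (metis (no_types, lifting) bounded_iff compact_Icc image_eqI real_norm_def)
  have ints: "(\<lambda>t. \<Sum>j<N. a j * (v * of_real (y t)) ^ j * of_real (\<phi> t)) integrable_on {0..1}" for N
    by (intro integrable_continuous_interval continuous_intros \<phi> y)
  have vy: "norm (v * of_real (y t)) < 1" "norm (v * of_real (y t)) \<le> norm v" if "t \<in> {0..1}" for t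
  proof -
    show le: "norm (v * of_real (y t)) \<le> norm v" using y(2)[OF that] by (simp add: norm_mult mult_left_le)
    thus "norm (v * of_real (y t)) < 1" using v by linarith
  qed
  have lim: "(\<lambda>N. integral {0..1} (\<lambda>t. \<Sum>j<N. a j * (v * of_real (y t)) ^ j * of_real (\<phi> t))) \<longlonglongrightarrow>
      integral {0..1} (\<lambda>t. H (v * of_real (y t)) * of_real (\<phi> t))"
  proof (rule dominated_convergence(2)[OF ints])
    show "(\<lambda>t. (\<Sum>j. norm (a j * v ^ j)) * B) integrable_on {0..1::real}" by (rule integrable_const_ivl)
    show "norm (\<Sum>j<N. a j * (v * of_real (y t)) ^ j * of_real (\<phi> t)) \<le> (\<Sum>j. norm (a j * v ^ j)) * B"
      if t: "t \<in> {0..1}" for N t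
    proof -
      have "norm (\<Sum>j<N. a j * (v * of_real (y t)) ^ j * of_real (\<phi> t)) \<le> (\<Sum>j<N. norm (a j * v ^ j) * B)"
      proof (rule sum_norm_le)
        fix j
        have "norm (a j * (v * of_real (y t)) ^ j) \<le> norm (a j * v ^ j)"
          unfolding norm_mult norm_power[of _ j] using vy(2)[OF t] by (intro mult_left_mono power_mono) (auto simp: norm_mult)
        thus "norm (a j * (v * of_real (y t)) ^ j * of_real (\<phi> t)) \<le> norm (a j * v ^ j) * B"
          unfolding norm_mult[of _ "of_real (\<phi> t)"] using B[OF t] by (intro mult_mono) auto
      qed
      also have "\<dots> \<le> (\<Sum>j. norm (a j * v ^ j)) * B"
        unfolding sum_distrib_right[symmetric] using B[OF t]
        by (intro mult_right_mono sum_le_suminf[OF sm]) auto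
      finally show ?thesis .
    qed
    show "(\<lambda>N. \<Sum>j<N. a j * (v * of_real (y t)) ^ j * of_real (\<phi> t)) \<longlonglongrightarrow> H (v * of_real (y t)) * of_real (\<phi> t)"
      if t: "t \<in> {0..1}" for t
      using sums_mult2[OF s[OF vy(1)[OF t]], of "of_real (\<phi> t)"] unfolding sums_def .
  qed
  have "integral {0..1} (\<lambda>t. \<Sum>j<N. a j * (v * of_real (y t)) ^ j * of_real (\<phi> t)) =
     (\<Sum>j<N. of_real (integral {0..1} (\<lambda>t. y t ^ j * \<phi> t)) * a j * v ^ j)" for N
  proof -
    have i: "((\<lambda>t. a j * (v * of_real (y t)) ^ j * of_real (\<phi> t)) has_integral
       of_real (integral {0..1} (\<lambda>t. y t ^ j * \<phi> t)) * a j * v ^ j) {0..1}" for j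
    proof -
      have "((\<lambda>t. y t ^ j * \<phi> t) has_integral integral {0..1} (\<lambda>t. y t ^ j * \<phi> t)) {0..1}"
        by (intro integrable_integral integrable_continuous_interval continuous_intros \<phi> y)
      from has_integral_mult_right[OF has_integral_of_real[OF this], of "a j * v ^ j"]
      show ?thesis by (simp add: power_mult_distrib mult_ac)
    qed
    show ?thesis by (intro integral_unique has_integral_sum i) auto
  qed
  with lim show "(\<lambda>j. of_real (integral {0..1} (\<lambda>t. y t ^ j * \<phi> t)) * a j * v ^ j) sums
      integral {0..1} (\<lambda>t. H (v * of_real (y t)) * of_real (\<phi> t))"
    by (simp add: sums_def)
qed

section \<open>Iterated Beta integrals\<close>

text \<open>The constant normalises the maximum of the kernel, attained at
  \<open>t = l / (l + 1)\<close>, to 1. There \<open>u = w = 1\<close>, and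
  \<open>x \<le> exp (x - 1)\<close> suffices because the exponents sum to 0. Values in
  \<open>[0, 1]\<close> are what \<open>halfplane_series_hadamard\<close> requires.\<close>

lemma beta_kernel_le_one:
  fixes t :: real
  assumes "t \<in> {0..1}" "l > 0"
  shows "(real l + 1) ^ (l + 1) / real l ^ l * (t ^ l * (1 - t)) \<le> 1"
proof -
  define u where "u = t * (real l + 1) / real l"
  define w where "w = (1 - t) * (real l + 1)"
  have u: "u \<ge> 0" and w: "w \<ge> 0" using assms by (auto simp: u_def w_def)
  have "(real l + 1) ^ (l + 1) / real l ^ l * (t ^ l * (1 - t)) = u ^ l * w"
    using assms by (simp add: u_def w_def power_mult_distrib power_divide)
  also have "\<dots> \<le> exp (u - 1) ^ l * exp (w - 1)"
    using u w exp_ge_add_one_self[of "u - 1"] exp_ge_add_one_self[of "w - 1"]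
    by (intro mult_mono power_mono) auto
  also have "\<dots> = exp (real l * (u - 1) + (w - 1))"
    by (simp add: exp_add exp_of_nat_mult)
  also have "real l * (u - 1) + (w - 1) = 0"
    using assms by (simp add: u_def w_def field_simps)
  finally show ?thesis by simp
qed

lemma has_integral_power_unit:
  "((\<lambda>y::real. y ^ n) has_integral 1 / real (Suc n)) {0..1}"
proof -
  have "((\<lambda>y::real. y ^ n) has_integral (1 ^ Suc n / real (Suc n) - 0 ^ Suc n / real (Suc n))) {0..1}"
  proof (intro fundamental_theorem_of_calculus)
    fix y :: real
    have "((\<lambda>y. y ^ Suc n / real (Suc n)) has_real_derivative real (Suc n) * y ^ (Suc n - Suc 0) / real (Suc n)) (at y within {0..1})"
      by (intro DERIV_cdivide DERIV_subset[OF DERIV_pow]) auto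
    thus "((\<lambda>y. y ^ Suc n / real (Suc n)) has_vector_derivative y ^ n) (at y within {0..1})"
      by (simp add: has_real_derivative_iff_has_vector_derivative)
  qed simp
  thus ?thesis by simp
qed

text \<open>The parameter \<open>n\<close> is separated from \<open>m\<close> to allow induction:
  \<open>n = 1\<close> gives the constant sequence 1, and \<open>n = m\<close> gives
  \<open>gamma_power_ratio m (j + 1)\<close>.\<close>

definition gamma_ratio_seq :: "nat \<Rightarrow> nat \<Rightarrow> nat \<Rightarrow> real" where
  "gamma_ratio_seq m n j = (real n ^ n) powr (real (Suc j) / real m) * Gamma (real (Suc j) / real m) ^ n / Gamma (real n * (real (Suc j) / real m))"

text \<open>With \<open>x = (j + 1) / m\<close>, consecutive sequences differ by the factor \<open>Beta (n x) x\<close>. Its integrand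
  is unbounded at the endpoints; the shift to \<open>Beta (n x + 1) (x + 1)\<close> gives a continuous kernel and
  costs only a linear factor and the factor \<open>1 / (j + 1)\<close>.\<close>

lemma gamma_ratio_seq_Suc:
  assumes m: "m > 0" and n: "n > 0"
  defines "y \<equiv> \<lambda>t. ((real n + 1) ^ (n + 1) / real n ^ n * (t ^ n * (1 - t))) powr (1 / real m)"
  shows "gamma_ratio_seq m (Suc n) j = real (n + 1) ^ 2 / real n * (real j + (1 + real m / (real n + 1))) *
     integral {0..1} (\<lambda>t. t ^ j * 1) * (integral {0..1} (\<lambda>t. y t ^ j * y t) * gamma_ratio_seq m n j)"
proof -
  define x where "x = real (Suc j) / real m"
  define \<kappa> where "\<kappa> = (real n + 1) ^ (n + 1) / real n ^ n"
  have x: "x > 0" using m by (simp add: x_def)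
  have \<kappa>: "\<kappa> > 0" using n by (simp add: \<kappa>_def)
  have i1: "integral {0..1} (\<lambda>t::real. t ^ j * 1) = 1 / real (Suc j)"
    using integral_unique[OF has_integral_power_unit[of j]] by simp
  \<comment> \<open>The exponent \<open>1 / m\<close> in \<open>y\<close> turns
    \<open>y ^ (j + 1)\<close> into the \<open>x\<close>-th power of the Beta kernel. The endpoints
    form a null set and are dropped so that \<open>powr\<close> has positive bases.\<close>
  have i2: "integral {0..1} (\<lambda>t. y t ^ j * y t) = \<kappa> powr x * Beta (real n * x + 1) (x + 1)"
  proof (rule integral_unique)
    have "((\<lambda>t. \<kappa> powr x * (t powr (real n * x + 1 - 1) * (1 - t) powr (x + 1 - 1))) has_integral
       \<kappa> powr x * Beta (real n * x + 1) (x + 1)) {0..1}"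
      using x by (intro has_integral_mult_right has_integral_Beta_real) (auto simp: add_nonneg_pos)
    moreover have "\<kappa> powr x * (t powr (real n * x + 1 - 1) * (1 - t) powr (x + 1 - 1)) = y t ^ j * y t"
      if t: "t \<in> {0..1} - {0, 1}" for t
    proof -
      have b: "\<kappa> * (t ^ n * (1 - t)) > 0" using t \<kappa> by auto
      have "y t > 0" unfolding y_def \<kappa>_def[symmetric] powr_gt_zero using b by linarith
      hence "y t ^ j * y t = y t powr (real (Suc j))" by (subst powr_realpow) auto
      also have "\<dots> = (\<kappa> * (t ^ n * (1 - t))) powr x"
        using m unfolding y_def \<kappa>_def[symmetric] by (simp add: powr_powr x_def)
      also have "\<dots> = \<kappa> powr x * (t powr (real n * x) * (1 - t) powr x)"
        using t \<kappa> by (simp add: powr_mult powr_powr flip: powr_realpow)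
      finally show ?thesis by simp
    qed
    ultimately show "((\<lambda>t. y t ^ j * y t) has_integral \<kappa> powr x * Beta (real n * x + 1) (x + 1)) {0..1}"
      by (subst has_integral_spike_eq[of "{0, 1}"]) simp_all
  qed
  have "Beta (real n * x + 1) (x + 1) * (real n + 1) * ((real n + 1) * x + 1) = Beta (real n * x) x * (real n * x)"
  proof -
    have nx: "real n * x > 0" using n x by simp
    have "real n * x \<notin> \<int>\<^sub>\<le>\<^sub>0" "x \<notin> \<int>\<^sub>\<le>\<^sub>0" using nx x by (auto elim!: nonpos_Ints_cases)
    note b = Beta_plus1_left[OF this(1), of x] Beta_plus1_right[OF this(2), of "real n * x + 1"]
    have "x * (Beta (real n * x + 1) (x + 1) * (real n + 1) * ((real n + 1) * x + 1)) =
        (real n * x + x) * ((real n * x + 1 + x) * Beta (real n * x + 1) (x + 1))" by (simp add: algebra_simps)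
    also have "\<dots> = x * ((real n * x + x) * Beta (real n * x + 1) x)" unfolding b(2) by (simp only: mult_ac)
    also have "\<dots> = x * (Beta (real n * x) x * (real n * x))" unfolding b(1) by (simp only: mult_ac)
    finally show ?thesis using x by simp
  qed
  hence b: "Beta (real n * x) x = (real n + 1) * ((real n + 1) * x + 1) / (real n * x) * Beta (real n * x + 1) (x + 1)"
    using n x by (simp add: field_simps)
  have "gamma_ratio_seq m (Suc n) j = gamma_ratio_seq m n j * (\<kappa> powr x * Beta (real n * x) x)"
  proof -
    have "\<kappa> * real n ^ n = real (Suc n) ^ Suc n" using n by (simp add: \<kappa>_def add.commute)
    hence 1: "(real (Suc n) ^ Suc n) powr x = \<kappa> powr x * (real n ^ n) powr x"
      using \<kappa> by (metis less_imp_le of_nat_0_le_iff powr_mult zero_le_power)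
    have "Gamma (real n * x) > 0" using n x by (intro Gamma_real_pos) auto
    moreover have "real n * x + x = real (Suc n) * x" by (simp add: algebra_simps)
    ultimately show ?thesis unfolding gamma_ratio_seq_def x_def[symmetric] 1 Beta_def by (simp add: field_simps del: of_nat_Suc)
  qed
  also have "\<dots> = (real n + 1) * ((real n + 1) * x + 1) / (real n * x) * (\<kappa> powr x * Beta (real n * x + 1) (x + 1)) * gamma_ratio_seq m n j"
    unfolding b by (simp only: mult_ac times_divide_eq_left times_divide_eq_right)
  also have "(real n + 1) * ((real n + 1) * x + 1) / (real n * x) = real (n + 1) ^ 2 / real n * (real j + (1 + real m / (real n + 1))) * (1 / real (Suc j))"
    using m n by (simp add: x_def divide_simps power2_eq_square) (simp add: algebra_simps)
  finally show ?thesis unfolding i1 i2 by simp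
qed

text \<open>The geometric series starts the induction. Each step mirrors the factors in
  \<open>gamma_ratio_seq_Suc\<close>: two Hadamard products for the integrals, one Euler operator
  for the linear factor.\<close>

lemma gamma_ratio_seq_halfplane_series:
  assumes m: "m > 0"
  shows "n > 0 \<Longrightarrow> \<exists>H. halfplane_series (\<lambda>j. of_real (gamma_ratio_seq m n j)) H"
proof (induction n rule: nat_induct_non_zero)
  case 1
  have "gamma_ratio_seq m 1 j = 1" for j
  proof -
    define x where "x = real (Suc j) / real m"
    have "Gamma x > 0" using m by (intro Gamma_real_pos) (auto simp: x_def)
    thus ?thesis unfolding gamma_ratio_seq_def x_def[symmetric] by simp
  qed
  thus ?case using halfplane_series_geometric by auto
next
  case (Suc n)
  define y where "y = (\<lambda>t. ((real n + 1) ^ (n + 1) / real n ^ n * (t ^ n * (1 - t))) powr (1 / real m))"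
  from Suc obtain H where H: "halfplane_series (\<lambda>j. of_real (gamma_ratio_seq m n j)) H" by auto
  have cy: "continuous_on {0..1} y"
    unfolding y_def using Suc m by (intro continuous_on_powr' continuous_intros) auto
  have y01: "y t \<in> {0..1}" if "t \<in> {0..1}" for t
  proof -
    have "(real n + 1) ^ (n + 1) / real n ^ n * (t ^ n * (1 - t)) \<le> 1"
         "(real n + 1) ^ (n + 1) / real n ^ n * (t ^ n * (1 - t)) \<ge> 0"
      using beta_kernel_le_one[OF that] Suc that by auto
    from powr_mono2[OF _ this(2,1), of "1 / real m"] show ?thesis by (simp add: y_def)
  qed
  note h1 = halfplane_series_hadamard[OF H cy y01 cy]
  note h2 = halfplane_series_hadamard[OF h1, of "\<lambda>t. t" "\<lambda>_. 1"]
  note h3 = halfplane_series_cmult[OF halfplane_series_euler[OF h2, of "of_real (1 + real m / (real n + 1))"],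
      of "of_real (real (n + 1) ^ 2 / real n)"]
  have "(\<lambda>j. of_real (gamma_ratio_seq m (Suc n) j)) = (\<lambda>j. of_real (real (n + 1) ^ 2 / real n) * ((of_nat j + of_real (1 + real m / (real n + 1))) *
     (of_real (integral {0..1} (\<lambda>t. t ^ j * 1)) * (of_real (integral {0..1} (\<lambda>t. y t ^ j * y t)) * complex_of_real (gamma_ratio_seq m n j)))))"
  proof
    fix j
    have e: "gamma_ratio_seq m (Suc n) j = real (n + 1) ^ 2 / real n * (real j + (1 + real m / (real n + 1))) *
        integral {0..1} (\<lambda>t. t ^ j * 1) * (integral {0..1} (\<lambda>t. y t ^ j * y t) * gamma_ratio_seq m n j)"
      unfolding y_def by (rule gamma_ratio_seq_Suc[OF m \<open>n > 0\<close>])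
    show "of_real (gamma_ratio_seq m (Suc n) j) = of_real (real (n + 1) ^ 2 / real n) * ((of_nat j + of_real (1 + real m / (real n + 1))) *
     (of_real (integral {0..1} (\<lambda>t. t ^ j * 1)) * (of_real (integral {0..1} (\<lambda>t. y t ^ j * y t)) * complex_of_real (gamma_ratio_seq m n j))))"
      unfolding e by (simp only: of_real_mult of_real_add of_real_of_nat_eq mult.assoc)
  qed
  thus ?case using h3 by (auto simp: continuous_on_id)
qed

lemma gamma_power_ratio_eq_gamma_ratio_seq:
  assumes "m > 0"
  shows "gamma_power_ratio m (of_nat (Suc j)) = of_real (gamma_ratio_seq m m j)"
proof -
  define x where "x = real (Suc j) / real m"
  have "exp (of_nat (Suc j) * complex_of_real (ln (real m))) = of_real (exp (real (Suc j) * ln (real m)))"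
    by (simp flip: exp_of_real)
  also have "exp (real (Suc j) * ln (real m)) = (real m ^ m) powr x"
    using assms by (simp add: powr_def x_def ln_realpow del: of_nat_Suc)
  finally have 1: "exp (of_nat (Suc j) * complex_of_real (ln (real m))) = of_real ((real m ^ m) powr x)" .
  have 2: "of_nat (Suc j) / of_nat m = complex_of_real x" by (simp add: x_def)
  have 3: "of_nat (Suc j) = complex_of_real (real m * x)" using assms by (simp add: x_def)
  have "gamma_power_ratio m (of_nat (Suc j)) = of_real ((real m ^ m) powr x) * Gamma (complex_of_real x) ^ m * rGamma (of_nat (Suc j))"
    unfolding gamma_power_ratio_def 1 2 ..
  also have "rGamma (of_nat (Suc j)) = inverse (complex_of_real (Gamma (real m * x)))"
    by (simp only: 3 rGamma_inverse_Gamma Gamma_complex_of_real)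
  finally show ?thesis unfolding gamma_ratio_seq_def x_def[symmetric] Gamma_complex_of_real
    by (simp only: divide_inverse of_real_mult of_real_power of_real_inverse)
qed

section \<open>The moment density\<close>

definition unit_root :: "nat \<Rightarrow> nat \<Rightarrow> complex" where
  "unit_root m q = cis (- (2 * pi * real q / real m))"

text \<open>The binomial coefficients from expanding the power of the sine. One factor
  \<open>unit_root m q\<close> is split off because the sine is taken at \<open>j + 1\<close>
  whereas the series is indexed by \<open>j\<close>.\<close>

definition unit_root_weight :: "nat \<Rightarrow> nat \<Rightarrow> complex" where
  "unit_root_weight m q = - (unit_root m q * of_nat (m choose q) * (- 1) ^ q / (2 * pi * \<i>) ^ m)"

text \<open>Euler's formula writes the sine as a multiple of \<open>1 - w\<close>, to which the
  binomial theorem applies. As \<open>x\<close> is a multiple of \<open>1 / m\<close>,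
  \<open>w ^ m = 1\<close>, so for odd \<open>m\<close> the outer binomial terms are 1 and
  -1.\<close>

lemma moment_residue_expansion:
  assumes m: "odd m"
  shows "moment_residue m j = (\<Sum>q\<in>{1..<m}. unit_root_weight m q * (gamma_power_ratio m (of_nat (Suc j)) * unit_root m q ^ j))"
proof -
  have m0: "m > 0" using m by (auto intro: Nat.gr0I)
  define x where "x = real (Suc j) / real m"
  define w where "w = cis (- (2 * pi * x))"
  have wq: "w ^ q = unit_root m q ^ Suc j" for q
    unfolding w_def unit_root_def Complex.DeMoivre x_def by (intro arg_cong[of _ _ cis]) (simp del: of_nat_Suc)
  have wm: "w ^ m = 1"
  proof -
    have "w ^ m = cis (2 * pi * (- real (Suc j)))" using m0 by (simp add: w_def Complex.DeMoivre x_def del: of_nat_Suc)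
    also have "\<dots> = 1" by (rule cis_multiple_2pi) simp
    finally show ?thesis .
  qed
  have sin: "sin (of_real (pi * x)) = cis (pi * x) * (1 - w) / (2 * \<i>)"
  proof -
    have "cis (pi * x) * w = cis (- (pi * x))" by (simp add: w_def cis_mult)
    hence "cis (pi * x) * (1 - w) = cis (pi * x) - cis (- (pi * x))" by (simp add: algebra_simps)
    also have "\<dots> = 2 * \<i> * of_real (sin (pi * x))" by (simp add: complex_eq_iff)
    finally show ?thesis unfolding sin_of_real by simp
  qed
  have "cis (pi * x) ^ m = cis (real (Suc j) * pi)"
    unfolding Complex.DeMoivre using m0 by (intro arg_cong[of _ _ cis]) (simp add: x_def del: of_nat_Suc)
  also have "\<dots> = (- 1) ^ Suc j"
    by (simp only: Complex.DeMoivre[symmetric] cis_pi)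
  finally have cp: "cis (pi * x) ^ m = (- 1) ^ Suc j" .
  have "(1 - w) ^ m = (\<Sum>q\<le>m. of_nat (m choose q) * (- w) ^ q)"
    using binomial_ring[of "- w" 1 m] by simp
  also have "{..m} = insert 0 (insert m {1..<m})" using m0 by auto
  also have "(\<Sum>q\<in>\<dots>. of_nat (m choose q) * (- w) ^ q) = 1 + ((- w) ^ m + (\<Sum>q\<in>{1..<m}. of_nat (m choose q) * (- w) ^ q))"
    using m0 by simp
  also have "(- w) ^ m = -1" using m wm by (simp add: power_minus_odd)
  finally have b: "(1 - w) ^ m = (\<Sum>q\<in>{1..<m}. of_nat (m choose q) * (- w) ^ q)" by simp
  have "of_nat (Suc j) / of_nat m = complex_of_real x" by (simp add: x_def)
  hence "moment_residue m j = (- 1) ^ j * gamma_power_ratio m (of_nat (Suc j)) * sin (of_real (pi * x)) ^ m / of_real pi ^ m"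
    unfolding moment_residue_def by (simp del: of_nat_Suc)
  also have "sin (of_real (pi * x)) ^ m = (- 1) ^ Suc j * (1 - w) ^ m / (2 * \<i>) ^ m"
    unfolding sin power_mult_distrib power_divide cp ..
  also have "(- 1) ^ j * gamma_power_ratio m (of_nat (Suc j)) * ((- 1) ^ Suc j * (1 - w) ^ m / (2 * \<i>) ^ m) / of_real pi ^ m =
      - (gamma_power_ratio m (of_nat (Suc j)) * (1 - w) ^ m / (2 * pi * \<i>) ^ m)"
  proof -
    have "(- 1) ^ j * (- 1) ^ Suc j = (- 1 :: complex)" by (cases "even j") auto
    moreover have "(- 1) ^ j * G * ((- 1) ^ Suc j * W / P) / Q = ((- 1) ^ j * (- 1) ^ Suc j) * (G * W / (P * Q))" for G W P Q :: complex
      by (simp only: mult_ac times_divide_eq_left times_divide_eq_right divide_divide_eq_left)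
    moreover have "(2 * \<i>) ^ m * of_real pi ^ m = (2 * of_real pi * \<i>) ^ m"
      by (simp only: power_mult_distrib mult_ac)
    ultimately show ?thesis by (simp only: of_real_mult of_real_numeral mult_minus1)
  qed
  also have "\<dots> = (\<Sum>q\<in>{1..<m}. unit_root_weight m q * (gamma_power_ratio m (of_nat (Suc j)) * unit_root m q ^ j))"
    unfolding b sum_distrib_left sum_distrib_right sum_divide_distrib sum_negf[symmetric]
    by (intro sum.cong refl) (simp add: unit_root_weight_def power_minus[of w] wq mult_ac)
  finally show ?thesis .
qed

section \<open>Identification of the moments\<close>

lemma moment_fun_multiple:
  assumes "m > 0"
  shows "moment_fun m (of_nat (m * k)) = of_real (fact (m * k) / (fact k ^ m * real m ^ (m * k)))"
proof -
  have g: "Gamma (of_nat n + 1) = (fact n :: complex)" for n by (metis Gamma_fact add.commute)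
  have 1: "of_nat (m * k) / of_nat m + 1 = (of_nat k + 1 :: complex)" using assms by simp
  have "exp (- of_nat (m * k) * complex_of_real (ln (real m))) = of_real (exp (- (real (m * k) * ln (real m))))"
    by (simp flip: exp_of_real)
  also have "exp (- (real (m * k) * ln (real m))) = 1 / real m ^ (m * k)"
    using assms by (simp only: exp_minus exp_of_nat_mult exp_ln of_nat_0_less_iff) (simp add: divide_inverse)
  finally have 2: "exp (- of_nat (m * k) * complex_of_real (ln (real m))) = of_real (1 / real m ^ (m * k))" .
  show ?thesis unfolding moment_fun_def rGamma_inverse_Gamma 1 2 g
    by (simp add: divide_simps)
qed

lemma fact_add_le_power: "fact (n + p) \<le> fact n * (real (n + p)) ^ p"
proof (induction p)
  case (Suc p)
  have "fact (n + Suc p) = real (n + Suc p) * fact (n + p)" by simp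
  also have "\<dots> \<le> real (n + Suc p) * (fact n * real (n + p) ^ p)" using Suc by (intro mult_left_mono) auto
  also have "\<dots> \<le> real (n + Suc p) * (fact n * real (n + Suc p) ^ p)"
    by (intro mult_left_mono power_mono) auto
  finally show ?case by (simp add: mult_ac)
qed simp

text \<open>Serves only to show that these numbers tend to 0. Of the \<open>m\<close> new factors in
  \<open>fact (m * Suc k)\<close> the top one is \<open>m (k + 1)\<close> and the others are at most
  \<open>m (k + 1) - 1\<close>, so consecutive terms have ratio at most
  \<open>(1 - u) ^ (m - 1)\<close>. Bernoulli's inequality bounds this by
  \<open>(2 k + 2) / (2 k + 3)\<close>, whose square is below
  \<open>(k + 1) / (k + 2)\<close>.\<close>

lemma multinomial_ratio_sq_le:
  assumes m: "m \<ge> 2"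
  shows "(fact (m * k) / (fact k ^ m * real m ^ (m * k)))\<^sup>2 \<le> 1 / (real k + 1)"
proof (induction k)
  case (Suc k)
  define A where "A = (\<lambda>k. fact (m * k) / (fact k ^ m * real m ^ (m * k)))"
  have A0: "A k \<ge> 0" for k by (simp add: A_def)
  define u where "u = 1 / (real m * (real k + 1))"
  have mk: "real m * (real k + 1) \<ge> 1"
    using m by (metis (mono_tags) One_nat_def Suc_eq_plus1 Suc_leI less_le_trans mult_pos_pos of_nat_1 of_nat_Suc of_nat_le_iff of_nat_mult pos2 zero_less_Suc add.commute)
  hence u: "0 < u" "u \<le> 1" by (auto simp: u_def divide_simps)
  have e1: "m * Suc k = Suc (m * k + (m - 1))" using m by simp
  have e2: "real (m * k + (m - 1)) = real m * (real k + 1) * (1 - u)" using m mk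
    by (simp add: u_def of_nat_diff field_simps)
  have "fact (m * Suc k) = real m * (real k + 1) * fact (m * k + (m - 1))"
    unfolding e1 fact_Suc using m by (simp add: of_nat_diff algebra_simps)
  also have "\<dots> \<le> real m * (real k + 1) * (fact (m * k) * (real m * (real k + 1) * (1 - u)) ^ (m - 1))"
    unfolding e2[symmetric] by (intro mult_left_mono fact_add_le_power) auto
  also have "\<dots> = fact (m * k) * (real m * (real k + 1)) ^ Suc (m - 1) * (1 - u) ^ (m - 1)"
    by (simp only: power_mult_distrib power_Suc mult_ac)
  also have "Suc (m - 1) = m" using m by simp
  finally have "A (Suc k) \<le> fact (m * k) * (real m * (real k + 1)) ^ m * (1 - u) ^ (m - 1) / (fact (Suc k) ^ m * real m ^ (m * Suc k))"
    unfolding A_def by (intro divide_right_mono) auto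
  also have "\<dots> = A k * (1 - u) ^ (m - 1)"
    using m by (simp add: A_def power_mult_distrib power_add divide_simps add.commute)
  finally have 1: "A (Suc k) \<le> A k * (1 - u) ^ (m - 1)" .
  have "(1 - u) ^ (m - 1) * (1 + real (m - 1) * u) \<le> (1 - u) ^ (m - 1) * (1 + u) ^ (m - 1)"
    using u by (intro mult_left_mono Bernoulli_inequality) auto
  also have "\<dots> = (1 - u\<^sup>2) ^ (m - 1)" by (simp flip: power_mult_distrib add: algebra_simps power2_eq_square)
  also have "\<dots> \<le> 1" using u by (intro power_le_one) (auto simp: power_le_one)
  finally have 2: "(1 - u) ^ (m - 1) * (1 + real (m - 1) * u) \<le> 1" .
  have "real (m - 1) * u \<ge> 1 / (2 * (real k + 1))"
  proof -
    have "real m * (real k + 1) \<le> (2 * (real m - 1)) * (real k + 1)" using m by (intro mult_right_mono) auto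
    thus ?thesis using m by (simp add: u_def of_nat_diff divide_simps algebra_simps)
  qed
  hence "(1 - u) ^ (m - 1) * (1 + 1 / (2 * (real k + 1))) \<le> (1 - u) ^ (m - 1) * (1 + real (m - 1) * u)"
    using u by (intro mult_left_mono) auto
  with 2 have "(1 - u) ^ (m - 1) * (1 + 1 / (2 * (real k + 1))) \<le> 1" by linarith
  moreover have "1 + 1 / (2 * (real k + 1)) = (2 * real k + 3) / (2 * real k + 2)" by (simp add: field_simps)
  ultimately have "(1 - u) ^ (m - 1) \<le> (2 * real k + 2) / (2 * real k + 3)" by (simp add: field_simps)
  hence "A (Suc k) \<le> A k * ((2 * real k + 2) / (2 * real k + 3))"
    using 1 A0[of k] by (meson mult_left_mono order.trans)
  hence "A (Suc k) ^ 2 \<le> (A k * ((2 * real k + 2) / (2 * real k + 3))) ^ 2"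
    using A0 by (intro power_mono)
  also have "\<dots> = A k ^ 2 * ((2 * real k + 2) / (2 * real k + 3)) ^ 2" by (simp only: power_mult_distrib)
  also have "\<dots> \<le> 1 / (real k + 1) * ((2 * real k + 2) / (2 * real k + 3)) ^ 2"
    using Suc unfolding A_def by (intro mult_right_mono) auto
  also have "\<dots> \<le> 1 / (real (Suc k) + 1)"
    by (simp add: divide_simps power2_eq_square) (simp add: algebra_simps)
  finally show ?case by (simp add: A_def)
qed simp

lemma moment_fun_multiple_tendsto_0:
  assumes m: "m \<ge> 2"
  shows "(\<lambda>k. moment_fun m (of_nat (m * k))) \<longlonglongrightarrow> 0"
proof -
  have "(\<lambda>k. (fact (m * k) / (fact k ^ m * real m ^ (m * k)))\<^sup>2) \<longlonglongrightarrow> 0"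
    by (rule tendsto_sandwich[OF _ _ tendsto_const, of _ _ _ "\<lambda>k. 1 / (real k + 1)"])
       (use multinomial_ratio_sq_le[OF m] in \<open>auto intro!: always_eventually\<close>, real_asymp)
  hence "(\<lambda>k. fact (m * k) / (fact k ^ m * real m ^ (m * k))) \<longlonglongrightarrow> 0"
    using tendsto_real_sqrt[of _ 0] by fastforce
  hence "(\<lambda>k. complex_of_real (fact (m * k) / (fact k ^ m * real m ^ (m * k)))) \<longlonglongrightarrow> complex_of_real 0"
    by (rule tendsto_of_real)
  moreover have "moment_fun m (of_nat (m * k)) = complex_of_real (fact (m * k) / (fact k ^ m * real m ^ (m * k)))" for k
    using m by (intro moment_fun_multiple) auto
  ultimately show ?thesis by simp
qed

text \<open>The difference \<open>y ^ s - y ^ t\<close> vanishes at \<open>y = 1\<close>, which makes the partial sums of the (possibly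
  divergent at 1) power series uniformly bounded.\<close>

lemma integral_moment_fun_diff:
  fixes \<rho> :: "complex \<Rightarrow> complex" and s t :: nat
  assumes m: "m > 0" and st: "s < t"
    and \<rho>: "\<And>y. norm y < 1 \<Longrightarrow> (\<lambda>j. moment_residue m j * y ^ j) sums \<rho> y"
  shows "integral {0..1} (\<lambda>y. of_real (y ^ s - y ^ t) * \<rho> (of_real y)) = moment_fun m (of_nat s) - moment_fun m (of_nat t)"
proof -
  define B where "B = norm (gamma_power_ratio m (of_real (1/2)))"
  have B0: "B \<ge> 0" by (simp add: B_def)
  have i: "((\<lambda>y. of_real (y ^ s - y ^ t) * (moment_residue m j * of_real y ^ j)) has_integral
      moment_residue m j * of_real (1 / real (Suc (s + j)) - 1 / real (Suc (t + j)))) {0..1}" for j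
  proof -
    from has_integral_mult_right[OF has_integral_of_real[OF has_integral_diff[OF has_integral_power_unit[of "s + j"] has_integral_power_unit[of "t + j"]]], of "moment_residue m j"]
    show ?thesis by (simp add: power_add algebra_simps del: of_nat_Suc)
  qed
  have "(\<lambda>N. integral {0..1} (\<lambda>y. \<Sum>j<N. of_real (y ^ s - y ^ t) * (moment_residue m j * of_real y ^ j))) \<longlonglongrightarrow>
      integral {0..1} (\<lambda>y. of_real (y ^ s - y ^ t) * \<rho> (of_real y))"
  proof (rule dominated_convergence(2))
    show "(\<lambda>y. \<Sum>j<N. of_real (y ^ s - y ^ t) * (moment_residue m j * of_real y ^ j)) integrable_on {0..1}" for N
      by (intro integrable_continuous_interval continuous_intros)
    show "(\<lambda>y. B * real (t - s)) integrable_on {0..1::real}" by (rule integrable_const_ivl)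
    fix y :: real assume y: "y \<in> {0..1}"
    have tr: "y ^ s - y ^ t = y ^ s * ((1 - y) * (\<Sum>i<t - s. y ^ i))"
    proof -
      have "y ^ s * ((1 - y) * (\<Sum>i<t - s. y ^ i)) = y ^ s * (1 - y ^ (t - s))" by (simp add: one_diff_power_eq)
      also have "\<dots> = y ^ s - y ^ t" using st by (simp add: right_diff_distrib flip: power_add)
      finally show ?thesis ..
    qed
    show "norm (\<Sum>j<N. of_real (y ^ s - y ^ t) * (moment_residue m j * of_real y ^ j)) \<le> B * real (t - s)" for N
    proof -
      have d0: "y ^ s - y ^ t \<ge> 0" using y st by (simp add: power_decreasing)
      have "norm (\<Sum>j<N. of_real (y ^ s - y ^ t) * (moment_residue m j * of_real y ^ j)) \<le> (\<Sum>j<N. (y ^ s - y ^ t) * (B * y ^ j))"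
      proof (rule sum_norm_le)
        fix j
        have "norm (complex_of_real (y ^ s - y ^ t)) = y ^ s - y ^ t" using d0 by (metis abs_of_nonneg norm_of_real)
        thus "norm (of_real (y ^ s - y ^ t) * (moment_residue m j * of_real y ^ j)) \<le> (y ^ s - y ^ t) * (B * y ^ j)"
          unfolding norm_mult using norm_moment_residue_le[OF m, of j] y d0
          by (auto simp: norm_power B_def intro!: mult_left_mono mult_right_mono)
      qed
      also have "\<dots> = B * (y ^ s * (\<Sum>i<t - s. y ^ i) * ((1 - y) * (\<Sum>j<N. y ^ j)))"
      proof -
        have "(\<Sum>j<N. (y ^ s - y ^ t) * (B * y ^ j)) = (y ^ s - y ^ t) * (B * (\<Sum>j<N. y ^ j))"
          by (simp add: sum_distrib_left)
        thus ?thesis unfolding tr by (simp only: mult_ac)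
      qed
      also have "(1 - y) * (\<Sum>j<N. y ^ j) = 1 - y ^ N" by (simp add: one_diff_power_eq)
      also have "B * (y ^ s * (\<Sum>i<t - s. y ^ i) * (1 - y ^ N)) \<le> B * (1 * (\<Sum>i<t - s. 1) * 1)"
        using y B0 by (intro mult_left_mono mult_mono sum_mono power_le_one sum_nonneg mult_nonneg_nonneg) (auto simp: power_le_one)
      finally show ?thesis by simp
    qed
    show "(\<lambda>N. \<Sum>j<N. of_real (y ^ s - y ^ t) * (moment_residue m j * of_real y ^ j)) \<longlonglongrightarrow> of_real (y ^ s - y ^ t) * \<rho> (of_real y)"
    \<comment> \<open>At \<open>y = 1\<close> the prefactor is 0, so the convergence of the series
      is not at stake.\<close>
    proof (cases "y = 1")
      case False
      thus ?thesis using sums_mult[OF \<rho>[of "of_real y"], of "of_real (y ^ s - y ^ t)"] y by (simp add: sums_def)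
    qed simp
  qed
  moreover have "(\<lambda>N. integral {0..1} (\<lambda>y. \<Sum>j<N. of_real (y ^ s - y ^ t) * (moment_residue m j * of_real y ^ j))) \<longlonglongrightarrow>
     moment_fun m (of_nat s) - moment_fun m (of_nat t)"
  proof -
    have "of_nat t - of_nat s \<noteq> (0::complex)" using st by simp
    with sums_mult[OF moment_fun_partial_fractions[OF m, of s t], of "of_nat t - of_nat s"] st
    have "(\<lambda>j. (of_nat t - of_nat s) * (moment_residue m j / ((of_nat (Suc j) + of_nat s) * (of_nat (Suc j) + of_nat t)))) sums
       (moment_fun m (of_nat s) - moment_fun m (of_nat t))" by simp
    moreover have "(of_nat t - of_nat s) * (moment_residue m j / ((of_nat (Suc j) + of_nat s) * (of_nat (Suc j) + of_nat t))) =
        moment_residue m j * of_real (1 / real (Suc (s + j)) - 1 / real (Suc (t + j)))" for j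
    proof -
      have ne: "(of_nat (Suc (s + j)) :: complex) \<noteq> 0" "(of_nat (Suc (t + j)) :: complex) \<noteq> 0"
        by (simp_all only: of_nat_eq_0_iff)
      have e: "of_nat (Suc j) + of_nat s = (of_nat (Suc (s + j)) :: complex)" "of_nat (Suc j) + of_nat t = (of_nat (Suc (t + j)) :: complex)"
         "of_nat t - of_nat s = (of_nat (Suc (t + j)) - of_nat (Suc (s + j)) :: complex)"
        by simp_all
      show ?thesis unfolding e using ne by (simp add: field_simps del: of_nat_Suc)
    qed
    moreover have "integral {0..1} (\<lambda>y. \<Sum>j<N. of_real (y ^ s - y ^ t) * (moment_residue m j * of_real y ^ j)) =
        (\<Sum>j<N. moment_residue m j * of_real (1 / real (Suc (s + j)) - 1 / real (Suc (t + j))))" for N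
      by (intro integral_unique has_integral_sum i) auto
    ultimately show ?thesis by (simp add: sums_def del: of_nat_Suc)
  qed
  ultimately show ?thesis by (rule LIMSEQ_unique)
qed

text \<open>Differences determine the moments up to a common constant. Along multiples of
  \<open>m\<close> both the integrals and \<open>moment_fun\<close> tend to 0, so the constant is
  0.\<close>

lemma integral_moment_fun:
  fixes \<rho> :: "complex \<Rightarrow> complex"
  assumes m: "m \<ge> 2" and cont: "continuous_on {0..1} (\<lambda>y. \<rho> (of_real y))"
    and \<rho>: "\<And>y. norm y < 1 \<Longrightarrow> (\<lambda>j. moment_residue m j * y ^ j) sums \<rho> y"
  shows "integral {0..1} (\<lambda>y. of_real (y ^ s) * \<rho> (of_real y)) = moment_fun m (of_nat s)"
proof -
  define I where "I = (\<lambda>s. integral {0..1} (\<lambda>y. of_real (y ^ s) * \<rho> (of_real y)))"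
  have int: "(\<lambda>y. of_real (y ^ s) * \<rho> (of_real y)) integrable_on {0..1}" for s
    by (intro integrable_continuous_interval continuous_intros cont)
  have diff: "I s - moment_fun m (of_nat s) = I t - moment_fun m (of_nat t)" if "s < t" for t
  proof -
    have "I s - I t = integral {0..1} (\<lambda>y. of_real (y ^ s) * \<rho> (of_real y) - of_real (y ^ t) * \<rho> (of_real y))"
      unfolding I_def by (intro integral_diff[symmetric] int)
    also have "\<dots> = moment_fun m (of_nat s) - moment_fun m (of_nat t)"
      using integral_moment_fun_diff[OF _ that \<rho>] m by (simp add: algebra_simps)
    finally show ?thesis by (simp add: algebra_simps)
  qed
  obtain B where B: "\<And>y. y \<in> {0..1} \<Longrightarrow> norm (\<rho> (of_real y)) \<le> B"
    using compact_continuous_image[OF cont] compact_imp_bounded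
    by (metis (no_types, lifting) bounded_iff compact_Icc image_eqI)
  have "norm (I t) \<le> B / real (Suc t)" for t
  proof -
    have p: "((\<lambda>y::real. B * y ^ t) has_integral B * (1 / real (Suc t))) {0..1}"
      by (intro has_integral_mult_right has_integral_power_unit)
    have "norm (I t) \<le> integral {0..1} (\<lambda>y. B * y ^ t)"
      unfolding I_def
    proof (rule integral_norm_bound_integral[OF int])
      show "(\<lambda>y. B * y ^ t) integrable_on {0..1}" using p by blast
      show "norm (of_real (y ^ t) * \<rho> (of_real y)) \<le> B * y ^ t" if "y \<in> {0..1}" for y
        using mult_right_mono[OF B[OF that], of "y ^ t"] that by (simp add: norm_mult norm_power mult.commute)
    qed
    thus ?thesis using integral_unique[OF p] by simp
  qed
  hence "(\<lambda>t. I t) \<longlonglongrightarrow> 0"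
    by (intro Lim_null_comparison[of I "\<lambda>t. B / real (Suc t)"]) (auto, real_asymp)
  hence "(\<lambda>k. I (m * k)) \<longlonglongrightarrow> 0"
    using LIMSEQ_subseq_LIMSEQ[of I 0 "\<lambda>k. m * k"] m by (simp add: strict_mono_def o_def)
  from tendsto_diff[OF this moment_fun_multiple_tendsto_0[OF m]]
  have "(\<lambda>k. I (m * k) - moment_fun m (of_nat (m * k))) \<longlonglongrightarrow> 0" by simp
  moreover have "eventually (\<lambda>k. I (m * k) - moment_fun m (of_nat (m * k)) = I s - moment_fun m (of_nat s)) sequentially"
    using eventually_gt_at_top[of s]
  proof eventually_elim
    case (elim k)
    have "k \<le> m * k" using m by (cases m) auto
    hence "s < m * k" using elim by linarith
    thus ?case using diff by presburger
  qed
  ultimately have "(\<lambda>_::nat. I s - moment_fun m (of_nat s)) \<longlonglongrightarrow> 0" by (rule Lim_transform_eventually)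
  hence "I s - moment_fun m (of_nat s) = 0" by (simp add: LIMSEQ_const_iff)
  thus ?thesis by (simp add: I_def)
qed

lemma Re_unit_root_less_1:
  assumes "q \<in> {1..<m}"
  shows "Re (unit_root m q) < 1"
proof -
  have "cos (2 * pi * real q / real m) \<noteq> 1"
  proof
    assume "cos (2 * pi * real q / real m) = 1"
    then obtain n :: int where "2 * pi * real q / real m = of_int n * 2 * pi" by (auto simp: cos_one_2pi_int)
    hence "real q = of_int n * real m" using assms by (simp add: field_simps)
    hence "int q = n * int m" by (metis of_int_eq_iff of_int_mult of_int_of_nat_eq)
    hence "int m dvd int q" by simp
    hence "m dvd q" by simp
    thus False using assms by (auto dest: dvd_imp_le)
  qed
  thus ?thesis by (simp add: unit_root_def less_le)
qed

theorem exists_moment_density: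
  assumes m: "odd m" "m \<ge> 2"
  shows "\<exists>\<rho>. \<rho> holomorphic_on {v. \<forall>q\<in>{1..<m}. Re (unit_root m q * v) < 1} \<and>
     (\<forall>k. integral {0..1} (\<lambda>y. of_real (y ^ (m * k)) * \<rho> (of_real y)) =
            of_real (fact (m * k) / (fact k ^ m * real m ^ (m * k))))"
proof -
  let ?U = "{v. \<forall>q\<in>{1..<m}. Re (unit_root m q * v) < 1}"
  obtain H where H: "halfplane_series (\<lambda>j. of_real (gamma_ratio_seq m m j)) H"
    using gamma_ratio_seq_halfplane_series[of m m] m by auto
  have hol: "H holomorphic_on {v. Re v < 1}" and s: "\<And>v. norm v < 1 \<Longrightarrow> (\<lambda>j. gamma_power_ratio m (of_nat (Suc j)) * v ^ j) sums H v"
    using H m by (auto simp: halfplane_series_def gamma_power_ratio_eq_gamma_ratio_seq simp del: of_nat_Suc)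
  define \<rho> where "\<rho> = (\<lambda>v. \<Sum>q\<in>{1..<m}. unit_root_weight m q * H (unit_root m q * v))"
  have hr: "\<rho> holomorphic_on ?U"
    unfolding \<rho>_def
    by (intro holomorphic_intros holomorphic_on_compose_gen[OF _ hol, unfolded o_def]) auto
  have sr: "(\<lambda>j. moment_residue m j * y ^ j) sums \<rho> y" if "norm y < 1" for y
  proof -
    have "(\<lambda>j. \<Sum>q\<in>{1..<m}. unit_root_weight m q * (gamma_power_ratio m (of_nat (Suc j)) * (unit_root m q * y) ^ j)) sums \<rho> y"
      unfolding \<rho>_def using that by (intro sums_sum sums_mult s) (simp add: norm_mult unit_root_def)
    moreover have "(\<Sum>q\<in>{1..<m}. unit_root_weight m q * (gamma_power_ratio m (of_nat (Suc j)) * (unit_root m q * y) ^ j)) = moment_residue m j * y ^ j" for j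
      unfolding moment_residue_expansion[OF m(1)] sum_distrib_right by (intro sum.cong) (simp_all add: power_mult_distrib mult_ac)
    ultimately show ?thesis by simp
  qed
  have sub: "of_real y \<in> ?U" if "y \<in> {0..1}" for y :: real
  proof -
    note Re_unit_root_less_1[of _ m]
    moreover have "a * y < 1" if "a < 1" for a
    proof (cases "y = 0")
      case False
      hence "a * y < 1 * y" using that \<open>y \<in> {0..1}\<close> by (intro mult_strict_right_mono) auto
      thus ?thesis using \<open>y \<in> {0..1}\<close> by simp
    qed simp
    ultimately show ?thesis by simp
  qed
  have "continuous_on {0..1} (\<lambda>y. \<rho> (of_real y))"
    using sub by (intro continuous_on_compose2[OF holomorphic_on_imp_continuous_on[OF hr]] continuous_intros) auto
  from integral_moment_fun[OF m(2) this sr] have "integral {0..1} (\<lambda>y. of_real (y ^ (m * k)) * \<rho> (of_real y)) =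
            of_real (fact (m * k) / (fact k ^ m * real m ^ (m * k)))" for k
    using moment_fun_multiple[of m k] m by simp
  with hr show ?thesis by blast
qed

section \<open>Integration by parts and the final estimate\<close>

lemma linear_power_dvd_pderiv:
  fixes p :: "'a :: idom poly"
  assumes "[:- a, 1:] ^ Suc k dvd p"
  shows "[:- a, 1:] ^ k dvd pderiv p"
proof -
  from assms obtain r where r: "p = [:- a, 1:] ^ Suc k * r" by blast
  have "pderiv p = [:- a, 1:] ^ k * ([:- a, 1:] * pderiv r + smult (of_nat (Suc k)) (pderiv [:- a, 1:] * r))"
    unfolding r pderiv_mult pderiv_power_Suc by (simp add: algebra_simps)
  thus ?thesis by (rule dvdI)
qed

lemma linear_power_dvd_higher_pderiv:
  fixes p :: "'a :: idom poly"
  assumes "[:- a, 1:] ^ (k + i) dvd p"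
  shows "[:- a, 1:] ^ k dvd (pderiv ^^ i) p"
  using assms by (induction i arbitrary: k) (auto intro!: linear_power_dvd_pderiv simp del: power_Suc)

text \<open>Makes the boundary terms vanish in the repeated integration by parts.\<close>

lemma higher_pderiv_root:
  fixes p :: "'a :: idom poly"
  assumes "[:- a, 1:] ^ n dvd p" "i < n"
  shows "poly ((pderiv ^^ i) p) a = 0"
proof -
  have "1 + i \<le> n" using assms(2) by simp
  from linear_power_dvd_higher_pderiv[OF dvd_trans[OF le_imp_power_dvd[OF this] assms(1)]] show ?thesis by (auto simp: dvd_def)
qed

lemma integral_pderiv_by_parts:
  fixes p :: "complex poly"
  assumes "open U" "g holomorphic_on U" "\<And>y. y \<in> {0..1} \<Longrightarrow> of_real y \<in> U" "poly p 0 = 0" "poly p 1 = 0"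
  shows "integral {0..1} (\<lambda>y. poly (pderiv p) (of_real y) * g (of_real y)) =
     - integral {0..1} (\<lambda>y. poly p (of_real y) * deriv g (of_real y))"
proof -
  have c: "continuous_on {0..1} (\<lambda>y. f (of_real y))" if "f holomorphic_on U" for f :: "complex \<Rightarrow> complex"
    using assms(3) by (intro continuous_on_compose2[OF holomorphic_on_imp_continuous_on[OF that]] continuous_intros) auto
  have "((\<lambda>y. poly (pderiv p) (of_real y) * g (of_real y) + poly p (of_real y) * deriv g (of_real y)) has_integral
      poly p (of_real 1) * g (of_real 1) - poly p (of_real 0) * g (of_real 0)) {0..1}"
  proof (rule fundamental_theorem_of_calculus)
    fix y :: real assume y: "y \<in> {0..1}"
    have "((\<lambda>z. poly p z * g z) has_field_derivative
       poly (pderiv p) (of_real y) * g (of_real y) + deriv g (of_real y) * poly p (of_real y)) (at (of_real y))"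
      by (intro DERIV_mult poly_DERIV holomorphic_derivI[OF assms(2,1)] assms(3) y)
    hence "((\<lambda>y. poly p (of_real y) * g (of_real y)) has_vector_derivative
       poly (pderiv p) (of_real y) * g (of_real y) + poly p (of_real y) * deriv g (of_real y)) (at y)"
      by (intro has_vector_derivative_real_field) (simp add: mult.commute)
    thus "((\<lambda>y. poly p (of_real y) * g (of_real y)) has_vector_derivative
       poly (pderiv p) (of_real y) * g (of_real y) + poly p (of_real y) * deriv g (of_real y)) (at y within {0..1})"
      by (rule has_vector_derivative_at_within)
  qed simp
  hence "integral {0..1} (\<lambda>y. poly (pderiv p) (of_real y) * g (of_real y) + poly p (of_real y) * deriv g (of_real y)) = 0"
    using assms by (simp add: integral_unique)
  moreover have "integral {0..1} (\<lambda>y. poly (pderiv p) (of_real y) * g (of_real y) + poly p (of_real y) * deriv g (of_real y)) =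
     integral {0..1} (\<lambda>y. poly (pderiv p) (of_real y) * g (of_real y)) + integral {0..1} (\<lambda>y. poly p (of_real y) * deriv g (of_real y))"
    using assms holomorphic_deriv[OF assms(2,1)]
    by (intro integral_add integrable_continuous_interval continuous_intros c) auto
  ultimately show ?thesis by (simp add: eq_neg_iff_add_eq_0)
qed

lemma integral_higher_pderiv_by_parts:
  fixes p :: "complex poly"
  assumes "open U" "g holomorphic_on U" "\<And>y. y \<in> {0..1} \<Longrightarrow> of_real y \<in> U"
    and "\<And>i. i < n \<Longrightarrow> poly ((pderiv ^^ i) p) 0 = 0" "\<And>i. i < n \<Longrightarrow> poly ((pderiv ^^ i) p) 1 = 0"
  shows "integral {0..1} (\<lambda>y. poly ((pderiv ^^ n) p) (of_real y) * g (of_real y)) =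
     (- 1) ^ n * integral {0..1} (\<lambda>y. poly p (of_real y) * (deriv ^^ n) g (of_real y))"
  using assms(2,4,5)
proof (induction n arbitrary: g)
  case (Suc n)
  have "integral {0..1} (\<lambda>y. poly ((pderiv ^^ Suc n) p) (of_real y) * g (of_real y)) =
     - integral {0..1} (\<lambda>y. poly ((pderiv ^^ n) p) (of_real y) * deriv g (of_real y))"
    unfolding funpow.simps o_def using Suc.prems
    by (intro integral_pderiv_by_parts[OF assms(1) _ assms(3)]) auto
  also have "integral {0..1} (\<lambda>y. poly ((pderiv ^^ n) p) (of_real y) * deriv g (of_real y)) =
     (- 1) ^ n * integral {0..1} (\<lambda>y. poly p (of_real y) * (deriv ^^ n) (deriv g) (of_real y))"
    using Suc.prems by (intro Suc.IH holomorphic_deriv assms(1)) auto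
  finally show ?case by (simp add: funpow_Suc_right del: funpow.simps)
qed simp

lemma higher_pderiv_monom_add:
  "(pderiv ^^ n) (monom c (n + k)) = monom (pochhammer (of_nat k + 1) n * c) k"
  by (rule poly_eqI) (auto simp: coeff_higher_pderiv add.commute)

definition alternating_sum :: "nat \<Rightarrow> nat \<Rightarrow> real" where
  "alternating_sum m n = (\<Sum>k\<le>n. (- 1) ^ (n - k) * fact (n + m * k) / (fact (n - k) * fact k ^ Suc m * real m ^ (m * k)))"

text \<open>The \<open>n\<close>-th derivative of \<open>y^(n + m k)\<close> is
  \<open>(n + m k)! / (m k)!\<close> times \<open>y^(m k)\<close>, and the moment of
  \<open>y^(m k)\<close> supplies a numerator that cancels \<open>(m k)!\<close>.\<close>

lemma alternating_sum_eq_integral: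
  fixes \<rho> :: "complex \<Rightarrow> complex"
  assumes m: "m > 0" and cont: "continuous_on {0..1} (\<lambda>y. \<rho> (of_real y))"
    and mom: "\<And>k. integral {0..1} (\<lambda>y. of_real (y ^ (m * k)) * \<rho> (of_real y)) = of_real (fact (m * k) / (fact k ^ m * real m ^ (m * k)))"
  shows "of_real (fact n * alternating_sum m n) =
    integral {0..1} (\<lambda>y. poly ((pderiv ^^ n) ((monom 1 1 * (monom 1 m - 1)) ^ n)) (of_real y) * \<rho> (of_real y))"
proof -
  have "(monom 1 1 * (monom 1 m - 1)) ^ n = monom 1 n * (- 1 + monom 1 m) ^ n"
    by (simp add: power_mult_distrib monom_power mult.commute)
  also have "(- 1 + monom 1 m) ^ n = (\<Sum>k\<le>n. of_nat (n choose k) * (monom 1 m) ^ k * (- 1) ^ (n - k))"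
    by (subst add.commute, rule binomial_ring)
  also have "monom 1 n * \<dots> = (\<Sum>k\<le>n. monom (of_nat (n choose k) * (- 1) ^ (n - k)) (n + m * k) :: complex poly)"
    unfolding sum_distrib_left
  proof (intro sum.cong refl)
    fix k
    have "(- 1 :: complex poly) ^ (n - k) = [:(- 1) ^ (n - k):]"
      by (metis poly_const_pow minus_pCons one_pCons minus_zero)
    thus "monom 1 n * (of_nat (n choose k) * monom 1 m ^ k * (- 1) ^ (n - k)) = (monom (of_nat (n choose k) * (- 1) ^ (n - k)) (n + m * k) :: complex poly)"
      by (simp add: of_nat_poly monom_power mult_monom smult_monom mult_ac)
  qed
  finally have e: "(monom 1 1 * (monom 1 m - 1)) ^ n = (\<Sum>k\<le>n. monom (of_nat (n choose k) * (- 1) ^ (n - k)) (n + m * k) :: complex poly)" .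
  have "(pderiv ^^ n) ((monom 1 1 * (monom 1 m - 1)) ^ n) = (\<Sum>k\<le>n. (pderiv ^^ n) (monom (of_nat (n choose k) * (- 1) ^ (n - k)) (n + m * k)) :: complex poly)"
    unfolding e by (rule higher_pderiv_sum)
  also have "\<dots> = (\<Sum>k\<le>n. monom (pochhammer (of_nat (m * k) + 1) n * (of_nat (n choose k) * (- 1) ^ (n - k))) (m * k))"
    unfolding higher_pderiv_monom_add ..
  finally have "poly ((pderiv ^^ n) ((monom 1 1 * (monom 1 m - 1)) ^ n)) y = (\<Sum>k\<le>n. pochhammer (of_nat (m * k) + 1) n * (of_nat (n choose k) * (- 1) ^ (n - k)) * y ^ (m * k))" for y :: complex
    by (simp add: poly_sum poly_monom)
  hence "integral {0..1} (\<lambda>y. poly ((pderiv ^^ n) ((monom 1 1 * (monom 1 m - 1)) ^ n)) (of_real y) * \<rho> (of_real y)) =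
     integral {0..1} (\<lambda>y. \<Sum>k\<le>n. pochhammer (of_nat (m * k) + 1) n * (of_nat (n choose k) * (- 1) ^ (n - k)) * (of_real (y ^ (m * k)) * \<rho> (of_real y)))"
    by (simp add: sum_distrib_right mult.assoc)
  also have "\<dots> = (\<Sum>k\<le>n. pochhammer (of_nat (m * k) + 1) n * (of_nat (n choose k) * (- 1) ^ (n - k)) * integral {0..1} (\<lambda>y. of_real (y ^ (m * k)) * \<rho> (of_real y)))"
    by (subst integral_sum) (auto intro!: integrable_continuous_interval continuous_intros cont)
  also have "\<dots> = of_real (fact n * alternating_sum m n)"
    unfolding alternating_sum_def sum_distrib_left of_real_sum mom
  proof (intro sum.cong refl)
    fix k assume k: "k \<in> {..n}"
    have p: "pochhammer (of_nat (m * k) + 1) n = complex_of_real (fact (n + m * k) / fact (m * k))"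
    proof -
      have "pochhammer (1 :: real) (m * k + n) = pochhammer 1 (m * k) * pochhammer (1 + real (m * k)) n"
        by (rule pochhammer_product')
      hence "pochhammer (real (m * k) + 1) n = fact (n + m * k) / fact (m * k)"
        by (simp add: pochhammer_fact[symmetric] add.commute field_simps)
      thus ?thesis by (metis of_real_1 of_real_add of_real_of_nat_eq pochhammer_of_real)
    qed
    have b: "of_nat (n choose k) = complex_of_real (fact n / (fact k * fact (n - k)))"
      using k binomial_fact[of k n, where ?'a = complex] by simp
    have "pochhammer (of_nat (m * k) + 1) n * (of_nat (n choose k) * (- 1) ^ (n - k)) * complex_of_real (fact (m * k) / (fact k ^ m * real m ^ (m * k))) =
      complex_of_real (fact (n + m * k) / fact (m * k) * (fact n / (fact k * fact (n - k)) * (- 1) ^ (n - k)) * (fact (m * k) / (fact k ^ m * real m ^ (m * k))))"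
      unfolding p b by simp
    also have "fact (n + m * k) / fact (m * k) * (fact n / (fact k * fact (n - k)) * (- 1) ^ (n - k)) * (fact (m * k) / (fact k ^ m * real m ^ (m * k))) =
       fact n * ((- 1) ^ (n - k) * fact (n + m * k) / (fact (n - k) * fact k ^ Suc m * real m ^ (m * k)))"
      by (simp add: mult_ac)
    finally show "pochhammer (of_nat (m * k) + 1) n * (of_nat (n choose k) * (- 1) ^ (n - k)) * complex_of_real (fact (m * k) / (fact k ^ m * real m ^ (m * k))) =
       complex_of_real (fact n * ((- 1) ^ (n - k) * fact (n + m * k) / (fact (n - k) * fact k ^ Suc m * real m ^ (m * k))))" .
  qed
  finally show ?thesis ..
qed

section \<open>The exponential gain\<close>

text \<open>Cauchy's estimate on a disc of radius \<open>r\<close> about \<open>y\<close> costs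
  \<open>r^(-n)\<close>, while the polynomial contributes at most \<open>(m y (1 - y))^n\<close>.
  The radius varies with \<open>y\<close> so that \<open>y (1 - y) \<le> \<theta> r\<close> on the
  whole interval with \<open>\<theta> < 1\<close>.\<close>

theorem alternating_sum_bound:
  assumes m: "odd m" "m \<ge> 2"
  shows "\<exists>K \<theta>. 0 < \<theta> \<and> \<theta> < 1 \<and> 0 \<le> K \<and> (\<forall>n. \<bar>alternating_sum m n\<bar> \<le> K * (real m * \<theta>) ^ n)"
proof -
  let ?U = "{v. \<forall>q\<in>{1..<m}. Re (unit_root m q * v) < 1}"
  obtain \<rho> where hol: "\<rho> holomorphic_on ?U"
    and mom: "\<And>k. integral {0..1} (\<lambda>y. of_real (y ^ (m * k)) * \<rho> (of_real y)) = of_real (fact (m * k) / (fact k ^ m * real m ^ (m * k)))"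
    using exists_moment_density[OF m] by blast
  \<comment> \<open>Inserting 0 keeps \<kappa> nonnegative: for \<open>m = 3\<close> both real parts
    are \<open>-1/2\<close>.\<close>
  define \<kappa> where "\<kappa> = Max (insert 0 ((\<lambda>q. Re (unit_root m q)) ` {1..<m}))"
  have \<kappa>0: "\<kappa> \<ge> 0" unfolding \<kappa>_def by (intro Max_ge) auto
  have \<kappa>q: "Re (unit_root m q) \<le> \<kappa>" if "q \<in> {1..<m}" for q unfolding \<kappa>_def using that by (intro Max_ge) auto
  have \<kappa>1: "\<kappa> < 1" unfolding \<kappa>_def using Re_unit_root_less_1[of _ m] by (subst Max_less_iff) auto
  \<comment> \<open>Chosen so that \<open>\<theta> (\<theta> - \<kappa> y) - y (1 - y)\<close> is
    the perfect square of \<open>y - \<theta>\<close>.\<close>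
  define \<theta> where "\<theta> = 1 / (2 - \<kappa>)"
  have \<theta>: "0 < \<theta>" "\<theta> < 1" "\<theta> * (2 - \<kappa>) = 1" using \<kappa>0 \<kappa>1 by (auto simp: \<theta>_def)
  have \<theta>\<kappa>: "\<theta> > \<kappa>"
  proof -
    have "\<theta> - \<kappa> = (1 - \<kappa>)\<^sup>2 / (2 - \<kappa>)" using \<kappa>1 by (simp add: \<theta>_def field_simps power2_eq_square)
    thus ?thesis using \<kappa>1 by (smt (verit) divide_pos_pos zero_less_power)
  qed
  have oU: "open ?U"
  proof -
    have "?U = (\<Inter>q\<in>{1..<m}. (\<lambda>v. unit_root m q * v) -` {z. Re z < 1})" by auto
    also have "open \<dots>"
      by (intro open_INT finite_atLeastLessThan ballI open_vimage open_halfspace_Re_lt continuous_intros)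
    finally show ?thesis .
  qed
  \<comment> \<open>A compact part of the domain, bounded away from its edge since
    \<open>\<theta> < 1\<close>, that contains all the discs; one bound for \<rho> then serves every
    \<open>y\<close>.\<close>
  define C where "C = {v. norm v \<le> 2 \<and> (\<forall>q\<in>{1..<m}. Re (unit_root m q * v) \<le> \<theta>)}"
  have "compact C"
  proof -
    have "C = cball 0 2 \<inter> (\<Inter>q\<in>{1..<m}. (\<lambda>v. unit_root m q * v) -` {z. Re z \<le> \<theta>})" by (auto simp: C_def)
    also have "compact \<dots>"
      by (intro compact_Int_closed compact_cball closed_INT ballI closed_vimage closed_halfspace_Re_le continuous_intros)
    finally show ?thesis .
  qed
  moreover have CU: "C \<subseteq> ?U" using \<theta> by (force simp: C_def)
  ultimately have "bounded (\<rho> ` C)"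
    using hol by (intro compact_imp_bounded compact_continuous_image) (auto intro: continuous_on_subset holomorphic_on_imp_continuous_on)
  then obtain K where K: "K > 0" "\<And>v. v \<in> C \<Longrightarrow> norm (\<rho> v) \<le> K"
    by (auto simp: bounded_pos)
  have r0: "\<theta> - \<kappa> * y > 0" if "y \<in> {0..1}" for y
  proof -
    have "\<kappa> * y \<le> \<kappa> * 1" using that \<kappa>0 by (intro mult_left_mono) auto
    thus ?thesis using \<theta>\<kappa> by simp
  qed
  have ballC: "cball (of_real y) (\<theta> - \<kappa> * y) \<subseteq> C" if y: "y \<in> {0..1}" for y
  proof
    fix v assume "v \<in> cball (complex_of_real y) (\<theta> - \<kappa> * y)"
    hence d: "norm (v - of_real y) \<le> \<theta> - \<kappa> * y" by (simp add: dist_norm norm_minus_commute)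
    have "norm v \<le> norm (v - of_real y) + norm (complex_of_real y)" using norm_triangle_sub[of v "complex_of_real y"] by simp
    also have "\<dots> \<le> (\<theta> - \<kappa> * y) + 1" using d y by (intro add_mono) auto
    also have "\<dots> \<le> 2" using \<theta> \<kappa>0 y by (smt (verit) atLeastAtMost_iff mult_nonneg_nonneg)
    finally have "norm v \<le> 2" .
    moreover have "Re (unit_root m q * v) \<le> \<theta>" if q: "q \<in> {1..<m}" for q
    proof -
      have "unit_root m q * v = of_real y * unit_root m q + unit_root m q * (v - of_real y)" by (simp add: algebra_simps)
      hence "Re (unit_root m q * v) = Re (of_real y * unit_root m q) + Re (unit_root m q * (v - of_real y))"
        by (metis plus_complex.sel(1))
      also have "Re (of_real y * unit_root m q) = y * Re (unit_root m q)" by simp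
      also have "y * Re (unit_root m q) + Re (unit_root m q * (v - of_real y)) \<le> y * \<kappa> + norm (unit_root m q * (v - of_real y))"
        using \<kappa>q[OF q] y by (intro add_mono mult_left_mono complex_Re_le_cmod) auto
      also have "norm (unit_root m q * (v - of_real y)) = norm (v - of_real y)" by (simp add: norm_mult unit_root_def)
      finally show ?thesis using d by (simp add: mult.commute)
    qed
    ultimately show "v \<in> C" by (simp add: C_def)
  qed
  have U01: "of_real y \<in> ?U" if "y \<in> {0..1}" for y
    using ballC[OF that] CU r0[OF that] by (meson centre_in_cball less_imp_le subsetD)
  have contg: "continuous_on {0..1} (\<lambda>y. g (of_real y))" if "g holomorphic_on ?U" for g :: "complex \<Rightarrow> complex"
    using U01 by (intro continuous_on_compose2[OF holomorphic_on_imp_continuous_on[OF that]] continuous_intros) auto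
  have "\<bar>alternating_sum m n\<bar> \<le> K * (real m * \<theta>) ^ n" for n
  proof -
    define p where "p = ((monom 1 1 * (monom 1 m - 1)) ^ n :: complex poly)"
    have d0: "[:- 0, 1:] ^ n dvd p"
      unfolding p_def by (intro dvd_power_same dvd_mult2) (simp add: monom_altdef)
    have d1: "[:- 1, 1:] ^ n dvd p"
      unfolding p_def by (intro dvd_power_same dvd_mult) (simp add: dvd_iff_poly_eq_0 poly_monom)
    have pv: "norm (poly p (of_real y)) = (y * (1 - y ^ m)) ^ n" if "y \<in> {0..1}" for y
    proof -
      have "poly p (of_real y) = of_real ((y * (y ^ m - 1)) ^ n)" by (simp add: p_def poly_monom)
      hence "norm (poly p (of_real y)) = \<bar>(y * (y ^ m - 1)) ^ n\<bar>" by (metis norm_of_real)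
      also have "\<dots> = (y * (1 - y ^ m)) ^ n" using that by (simp add: power_abs abs_mult power_le_one)
      finally show ?thesis .
    qed
    have "complex_of_real (fact n * alternating_sum m n) = (- 1) ^ n * integral {0..1} (\<lambda>y. poly p (of_real y) * (deriv ^^ n) \<rho> (of_real y))"
      using alternating_sum_eq_integral[OF _ contg[OF hol] mom, of n] m
        integral_higher_pderiv_by_parts[OF oU hol U01, of n p] higher_pderiv_root[OF d0] higher_pderiv_root[OF d1]
      by (simp add: p_def)
    hence "norm (complex_of_real (fact n * alternating_sum m n)) = norm (integral {0..1} (\<lambda>y. poly p (of_real y) * (deriv ^^ n) \<rho> (of_real y)))"
      by (simp only: norm_mult norm_power norm_minus_cancel norm_one power_one mult_1_left)
    also have "\<dots> \<le> fact n * K * (real m * \<theta>) ^ n * (1 - 0)"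
    proof (rule integral_bound)
      show "continuous_on {0..1} (\<lambda>y. poly p (of_real y) * (deriv ^^ n) \<rho> (of_real y))"
        by (intro continuous_intros contg holomorphic_higher_deriv hol oU)
      fix y :: real assume y: "y \<in> {0..1}"
      define r where "r = \<theta> - \<kappa> * y"
      have r: "r > 0" using r0[OF y] by (simp add: r_def)
      have 1: "norm ((deriv ^^ n) \<rho> (of_real y)) \<le> fact n * K / r ^ n"
      proof (rule Cauchy_inequality[OF _ _ r])
        have sub: "cball (of_real y) r \<subseteq> ?U" using ballC[OF y] CU by (simp add: r_def)
        show "\<rho> holomorphic_on ball (of_real y) r" using hol sub ball_subset_cball by (blast intro: holomorphic_on_subset)
        show "continuous_on (cball (of_real y) r) \<rho>" using hol sub by (blast intro: holomorphic_on_subset holomorphic_on_imp_continuous_on)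
        show "norm (\<rho> x) \<le> K" if "norm (of_real y - x) = r" for x
          using ballC[OF y] that by (intro K) (auto simp: r_def dist_norm)
      qed
      have "y * (1 - y ^ m) \<le> real m * \<theta> * r"
      proof -
        have "1 - y ^ m = (1 - y) * (\<Sum>i<m. y ^ i)" by (rule one_diff_power_eq)
        also have "\<dots> \<le> (1 - y) * (\<Sum>i<m. 1)" using y by (intro mult_left_mono sum_mono power_le_one) auto
        finally have "y * (1 - y ^ m) \<le> y * ((1 - y) * real m)" using y by (intro mult_left_mono) auto
        also have "\<dots> = (y * (1 - y)) * real m" by simp
        also have "y * (1 - y) \<le> \<theta> * r"
        proof -
          have "\<theta> * r - y * (1 - y) = (y - \<theta>)\<^sup>2 + y * (\<theta> * (2 - \<kappa>) - 1)" by (simp add: r_def power2_eq_square algebra_simps)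
          also have "\<dots> = (y - \<theta>)\<^sup>2" unfolding \<theta>(3) by simp
          finally show ?thesis by (smt (verit) zero_le_power2)
        qed
        finally show ?thesis by (simp add: mult_ac mult_right_mono)
      qed
      hence 2: "(y * (1 - y ^ m)) ^ n \<le> (real m * \<theta> * r) ^ n" using y by (intro power_mono) (auto simp: power_le_one)
      have "norm (poly p (of_real y) * (deriv ^^ n) \<rho> (of_real y)) \<le> (real m * \<theta> * r) ^ n * (fact n * K / r ^ n)"
        unfolding norm_mult pv[OF y] using 1 2 r \<theta> by (intro mult_mono) auto
      also have "\<dots> = fact n * K * (real m * \<theta>) ^ n" using r by (simp add: power_mult_distrib)
      finally show "norm (poly p (of_real y) * (deriv ^^ n) \<rho> (of_real y)) \<le> fact n * K * (real m * \<theta>) ^ n" .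
    qed simp
    finally have "fact n * \<bar>alternating_sum m n\<bar> \<le> fact n * (K * (real m * \<theta>) ^ n)"
      unfolding norm_of_real by (simp add: abs_mult mult.assoc)
    thus ?thesis by (simp add: mult_le_cancel_left_pos)
  qed
  with \<theta> K(1) show ?thesis by (intro exI[of _ K] exI[of _ \<theta>]) auto
qed

section \<open>Growth rate of the diagonal\<close>

lemma word_coeff_diagonal_eq_alternating_sum:
  assumes d: "CARD('d::finite) = Suc m" and m: "m > 0"
  shows "word_coeff (of_nat (m ^ m)) (\<lambda>_ :: 'd. n) = of_real (real (m ^ m) ^ n * alternating_sum m n)"
  unfolding word_coeff_diagonal alternating_sum_def sum_distrib_left of_real_sum
proof (intro sum.cong refl)
  fix k assume "k \<in> {..n}"
  hence k: "k \<le> n" by simp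
  have e: "n - k + CARD('d) * k = n + m * k" using k by (simp add: d)
  have "(- of_nat (m ^ m)) ^ (n - k) = complex_of_real ((- 1) ^ (n - k) * (real (m ^ m) ^ n / real m ^ (m * k)))"
    using m k by (simp add: power_minus[of "of_nat m ^ m"] power_diff power_mult)
  thus "(- of_nat (m ^ m)) ^ (n - k) * (fact (n - k + CARD('d) * k) / (fact (n - k) * fact k ^ CARD('d))) =
    complex_of_real (real (m ^ m) ^ n * ((- 1) ^ (n - k) * fact (n + m * k) / (fact (n - k) * fact k ^ Suc m * real m ^ (m * k))))"
    unfolding e by (simp add: d field_simps)
qed

text \<open>The constant disappears because \<open>K powr (1 / (d n))\<close> tends to 1 for
  positive \<open>K\<close>.\<close>

lemma limsup_root_le:
  fixes x :: "nat \<Rightarrow> real"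
  assumes "K > 0" "C > 0" "d > 0" and x: "\<And>n. x n \<ge> 0" "\<And>n. x n \<le> K * C ^ n"
  shows "limsup (\<lambda>n. ereal (x n powr (1 / (real d * real n)))) \<le> ereal (C powr (1 / real d))"
proof -
  have "(\<lambda>n. K powr (1 / (real d * real n)) * C powr (1 / real d)) \<longlonglongrightarrow> 1 * C powr (1 / real d)"
  proof (intro tendsto_mult tendsto_const)
    have "(\<lambda>n. 1 / (real d * real n)) \<longlonglongrightarrow> 0" using assms by real_asymp
    from tendsto_powr[OF tendsto_const this, of K] show "(\<lambda>n. K powr (1 / (real d * real n))) \<longlonglongrightarrow> 1"
      using assms by simp
  qed
  hence lim: "limsup (\<lambda>n. ereal (K powr (1 / (real d * real n)) * C powr (1 / real d))) = ereal (C powr (1 / real d))"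
    by (intro lim_imp_Limsup) auto
  have "limsup (\<lambda>n. ereal (x n powr (1 / (real d * real n)))) \<le>
      limsup (\<lambda>n. ereal (K powr (1 / (real d * real n)) * C powr (1 / real d)))"
  proof (rule Limsup_mono)
    show "\<forall>\<^sub>F n in sequentially. ereal (x n powr (1 / (real d * real n))) \<le> ereal (K powr (1 / (real d * real n)) * C powr (1 / real d))"
      using eventually_gt_at_top[of 0]
    proof eventually_elim
      case (elim n)
      have "x n powr (1 / (real d * real n)) \<le> (K * C ^ n) powr (1 / (real d * real n))"
        using x by (intro powr_mono2) auto
      also have "\<dots> = K powr (1 / (real d * real n)) * C powr (1 / real d)"
        using assms elim by (simp add: powr_mult powr_powr flip: powr_realpow)
      finally show ?case by simp
    qed
  qed
  also note lim
  finally show ?thesis .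
qed

theorem theorem12:
  fixes d :: nat and c_star :: complex and \<delta> :: "nat \<Rightarrow> complex"
  assumes "CARD('d::finite) = d" and "d \<ge> 4" and "even d"
    and "c_star = of_nat ((d - 1) ^ (d - 1))"
    and "\<And>n. \<delta> n = power_series_coeff (F c_star :: complex ^ 'd \<Rightarrow> complex) (\<lambda>_. n)"
  shows "limsup (\<lambda>n. ereal (cmod (\<delta> n) powr (1 / (real d * real n)))) < ereal (real d - 1)"
proof -
  define m where "m = d - 1"
  have d: "d = Suc m" and m: "odd m" "m \<ge> 2" using assms(2,3) by (auto simp: m_def)
  obtain K \<theta> where \<theta>: "0 < \<theta>" "\<theta> < 1" and K: "0 \<le> K" and bd: "\<And>n. \<bar>alternating_sum m n\<bar> \<le> K * (real m * \<theta>) ^ n"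
    using alternating_sum_bound[OF m] by blast
  \<comment> \<open>The scaling contributes \<open>m^m\<close> and the integral bound
    \<open>m \<theta>\<close>; with \<open>d = m + 1\<close> the \<open>d\<close>-th root of the
    product is \<open>m\<close> times a number below 1.\<close>
  define C where "C = real m ^ d * \<theta>"
  have C: "C > 0" using m \<theta> by (simp add: C_def)
  \<comment> \<open>\<open>K\<close> may be 0, whereas \<open>limsup_root_le\<close> asks for a
    positive constant; hence \<open>K + 1\<close>.\<close>
  have \<delta>: "norm (\<delta> n) \<le> (K + 1) * C ^ n" for n
  proof -
    have "\<delta> n = of_real (real (m ^ m) ^ n * alternating_sum m n)"
      unfolding assms(4,5) power_series_coeff_F m_def[symmetric]
      by (rule word_coeff_diagonal_eq_alternating_sum) (use assms(1) d m in auto)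
    hence "norm (\<delta> n) = real (m ^ m) ^ n * \<bar>alternating_sum m n\<bar>"
      by (metis abs_mult abs_of_nat norm_of_real power_abs)
    also have "\<dots> \<le> real (m ^ m) ^ n * (K * (real m * \<theta>) ^ n)" by (intro mult_left_mono bd) auto
    also have "\<dots> = K * C ^ n" by (simp add: C_def d power_mult_distrib mult_ac)
    also have "\<dots> \<le> (K + 1) * C ^ n" using C by (intro mult_right_mono) auto
    finally show ?thesis .
  qed
  have "limsup (\<lambda>n. ereal (cmod (\<delta> n) powr (1 / (real d * real n)))) \<le> ereal (C powr (1 / real d))"
    using K C d \<delta> by (intro limsup_root_le[where K = "K + 1"]) auto
  also have "C powr (1 / real d) = real m * \<theta> powr (1 / real d)"
  proof -
    have "real m ^ d = real m powr real d" using m by (simp add: powr_realpow)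
    hence "(real m ^ d) powr (1 / real d) = real m" using m d by (simp only: powr_powr) simp
    thus ?thesis using \<theta> by (simp add: C_def powr_mult)
  qed
  finally have le: "limsup (\<lambda>n. ereal (cmod (\<delta> n) powr (1 / (real d * real n)))) \<le> ereal (real m * \<theta> powr (1 / real d))" .
  have "real m * \<theta> powr (1 / real d) < real m * 1"
    using \<theta> m d powr_less_mono2[of "1 / real d" \<theta> 1] by (intro mult_strict_left_mono) auto
  hence "ereal (real m * \<theta> powr (1 / real d)) < ereal (real d - 1)" using d by simp
  with le show ?thesis by (rule le_less_trans)
qed

end
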